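(* Let $\varphi\in C^1(X,\mathbb{R})$ be an even functional such that $\nabla\varphi$ is weakly sequentially continuous and such that $\varphi$ satisfies the $(PS)^c$ condition for every $c\in\mathbb{R}$. Suppose that for every $k\in\mathbb{N}$ there exist $\rho_k>r_k>0$ such that: $(A_1)$ $d_k:=\sup_{u\in Y_k,\ \|u\|\le\rho_k}\varphi(u)<\infty$; $(A_2)'$ $a_k:=\sup_{u\in Y_k,\ \|u\|=\rho_k}\varphi(u)<\inf_{u\in Z_k,\ \|u\|\le r_k}\varphi(u)$; $(A_3)$ $b_k:=\inf_{u\in Z_k,\ \|u\|=r_k}\varphi(u)\to\infty$ as $k\to\infty$; and suppose moreover that $(A_4)$ for every $\delta>0$ there is a constant $C_\delta$ with $\sup_{\|u\|_\tau<\delta}\varphi(u)\le C_\delta<\infty$. Then $\varphi$ has a sequence of critical points $\{u^{k_m}\}_{m}\subset X$ such that $\lim_{m\to\infty}\|u^{k_m}\|=\infty$.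
   Context: $X$ is a separable (real) Hilbert space with inner product $\langle\cdot,\cdot\rangle$ and norm $\|\cdot\|$, $Y\subset X$ is a closed subspace, $Z=Y^\perp$, so $X=Y\oplus Z$; $\{e_j\}_{j\ge0}$ and $\{f_j\}_{j\ge0}$ are orthonormal bases of $Y$ and $Z$ respectively (both infinite). Set $$Y_k:=Y\oplus\Big(\bigoplus_{j=0}^k\mathbb{R}f_j\Big),\qquad Z_k:=\overline{\bigoplus_{j=k}^\infty\mathbb{R}f_j}.$$ $P:X\to Y$ and $Q:X\to Z$ are the orthogonal projections. The $\tau$-norm on $X$ is $$\|u\|_\tau:=\max\Big\{\sum_{j=0}^\infty\frac{1}{2^{j+1}}|\langle Pu,e_j\rangle|,\ \|Qu\|\Big\}.$$ For $\varphi\in C^1(X,\mathbb{R})$, $\nabla\varphi$ is defined by $\langle\nabla\varphi(u),v\rangle=\varphi'(u)v$ for all $v\in X$. "$\nabla\varphi$ is weakly sequentially continuous" means: if $u_n\rightharpoonup u$ weakly in $X$, then $\varphi'(u_n)v\to\varphi'(u)v$ for every $v\in X$. $\varphi$ satisfies the $(PS)^c$ condition if every sequence $\{u_n\}\subset X$ with $\sup_n\varphi(u_n)\le c$ and $\varphi'(u_n)\to0$ in the dual space $X'$ has a (norm-)convergent subsequence. Even means $\varphi(-u)=\varphi(u)$. A critical point is $u\in X$ with $\varphi'(u)=0$. *)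

theory Defs
  imports "HOL-Analysis.Analysis"
begin

definition orthonormal_basis_of :: "'a::real_inner set \<Rightarrow> (nat \<Rightarrow> 'a) \<Rightarrow> bool" where
  "orthonormal_basis_of S b \<longleftrightarrow>
     (\<forall>i j. b i \<bullet> b j = (if i = j then 1 else 0)) \<and> closure (span (range b)) = S"

text \<open>Meaningful when \<open>S\<close> is a closed subspace of a complete space, where the projection
  exists and is unique.\<close>

definition orth_proj :: "'a::real_inner set \<Rightarrow> 'a \<Rightarrow> 'a" where
  "orth_proj S u = (THE p. p \<in> S \<and> u - p \<in> orthogonal_comp S)"

definition Yk :: "'a::real_inner set \<Rightarrow> (nat \<Rightarrow> 'a) \<Rightarrow> nat \<Rightarrow> 'a set" where
  "Yk Y f k = {y + z | y z. y \<in> Y \<and> z \<in> span (f ` {..k})}"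

definition Zk :: "(nat \<Rightarrow> 'a::real_inner) \<Rightarrow> nat \<Rightarrow> 'a set" where
  "Zk f k = closure (span (f ` {k..}))"

text \<open>The series converges for every \<open>u\<close> whenever \<open>e\<close> is orthonormal, since its terms are
  bounded by \<open>norm u / 2 ^ (j + 1)\<close>.\<close>

definition tau_norm :: "'a::real_inner set \<Rightarrow> (nat \<Rightarrow> 'a) \<Rightarrow> 'a \<Rightarrow> real" where
  "tau_norm Y e u =
     max (\<Sum>j. 1 / 2 ^ (j + 1) * \<bar>orth_proj Y u \<bullet> e j\<bar>)
         (norm (orth_proj (orthogonal_comp Y) u))"

text \<open>The Frechet derivative \<open>\<phi>'(u)\<close> as an element of the dual space, which carries the operator
  norm; meaningful where \<open>\<phi>\<close> is differentiable.\<close>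

definition dual_deriv :: "('a::real_normed_vector \<Rightarrow> real) \<Rightarrow> 'a \<Rightarrow> 'a \<Rightarrow>\<^sub>L real" where
  "dual_deriv \<phi> u = Blinfun (frechet_derivative \<phi> (at u))"

definition C1_functional :: "('a::real_normed_vector \<Rightarrow> real) \<Rightarrow> bool" where
  "C1_functional \<phi> \<longleftrightarrow>
     (\<forall>u. \<phi> differentiable (at u)) \<and> continuous_on UNIV (dual_deriv \<phi>)"

definition weakly_converges :: "(nat \<Rightarrow> 'a::real_normed_vector) \<Rightarrow> 'a \<Rightarrow> bool" where
  "weakly_converges x l \<longleftrightarrow> (\<forall>L :: 'a \<Rightarrow>\<^sub>L real. (\<lambda>n. blinfun_apply L (x n)) \<longlonglongrightarrow> blinfun_apply L l)"

text \<open>The gradient enters only through \<open>\<langle>\<nabla>\<phi>(u), v\<rangle> = \<phi>'(u) v\<close>.\<close>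

definition gradient_weakly_seq_continuous :: "('a::real_normed_vector \<Rightarrow> real) \<Rightarrow> bool" where
  "gradient_weakly_seq_continuous \<phi> \<longleftrightarrow>
     (\<forall>x l. weakly_converges x l \<longrightarrow>
        (\<forall>v. (\<lambda>n. blinfun_apply (dual_deriv \<phi> (x n)) v) \<longlonglongrightarrow> blinfun_apply (dual_deriv \<phi> l) v))"

text \<open>The level is only bounded from above: \<open>\<phi>(x\<^sub>n)\<close> is not required to converge to \<open>c\<close>.\<close>

definition PS_condition :: "('a::real_normed_vector \<Rightarrow> real) \<Rightarrow> real \<Rightarrow> bool" where
  "PS_condition \<phi> c \<longleftrightarrow>
     (\<forall>x :: nat \<Rightarrow> 'a. (SUP n. ereal (\<phi> (x n))) \<le> ereal c \<longrightarrow> (\<lambda>n. dual_deriv \<phi> (x n)) \<longlonglongrightarrow> 0 \<longrightarrow>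
        (\<exists>s :: nat \<Rightarrow> nat. strict_mono s \<and> convergent (x \<circ> s)))"

definition critical_point :: "('a::real_normed_vector \<Rightarrow> real) \<Rightarrow> 'a \<Rightarrow> bool" where
  "critical_point \<phi> u \<longleftrightarrow> dual_deriv \<phi> u = 0"

end

theory Submission
  imports Defs "HOL-Library.Z2"
begin

text \<open>Fix \<open>m\<close>; it is enough to find a critical point of norm at least \<open>m\<close>. The \<open>\<tau>\<close>-norm is at most
the norm, so \<open>(A4)\<close> bounds \<open>\<phi>\<close> by some \<open>C\<close> on the ball of radius \<open>m\<close>, and a critical point at level
at least \<open>C + 1\<close> lies outside that ball. Choose \<open>k\<close> so large that \<open>\<phi> > C + 1\<close> on the sphere of radius
\<open>r\<^sub>k\<close> in \<open>Z\<^sub>k\<close>, and let \<open>D\<close> bound \<open>\<phi>\<close> on the disk of radius \<open>\<rho>\<^sub>k\<close> in \<open>Y\<^sub>k\<close>. By the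
Palais-Smale condition, it suffices to find, for every \<open>\<epsilon> > 0\<close>, a point with \<open>C + 1 \<le> \<phi> \<le> D\<close> and
\<open>\<parallel>\<phi>'\<parallel> < \<epsilon>\<close>.

The disk is deformed by maps \<open>u \<mapsto> u - h u\<close>, where \<open>h\<close> is odd, turns weak convergence in the disk
into norm convergence, and satisfies \<open>\<phi> (u - h u) \<le> \<phi> u\<close>. These \<open>h\<close> form a closed set in the Banach
space of bounded continuous maps, and they take the place of the flow and of the infinite-dimensional
degree of the classical proof. Three facts give the result.

\<^item> Linking (\<open>odd_compact_displacement_linking\<close>). Every deformed disk meets the sphere of radius \<open>r\<^sub>k\<close>
  in \<open>Z\<^sub>k\<close>. The deformed boundary cannot meet the ball of radius \<open>r\<^sub>k\<close> in \<open>Z\<^sub>k\<close>, because \<open>\<phi>\<close> has not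
  increased and \<open>(A2)'\<close> separates the values. A Galerkin approximation then reduces the claim to
  finite dimension, where it is Borsuk's theorem for a symmetric neighbourhood of the origin
  (\<open>borsuk_zero\<close>). That theorem rests on a Ky Fan count of alternating simplices on the integer grid.

\<^item> Semicontinuity (\<open>tau_weak_upper_semicontinuity\<close>). Together with the weak continuity
  of the gradient, \<open>(A4)\<close> makes \<open>\<phi>\<close> upper semicontinuous along sequences that converge both weakly and in
  the \<open>\<tau>\<close>-norm. If adding a weakly null,
  \<open>\<tau>\<close>-small vector could raise \<open>\<phi>\<close> by a fixed amount, then many such vectors could be added one after
  the other, each with almost the same gain, and \<open>\<phi>\<close> would be unbounded on a \<open>\<tau>\<close>-ball.

\<^item> Improvement (\<open>level_improvable\<close>). If \<open>\<parallel>\<phi>'\<parallel> \<ge> \<epsilon>\<close> at all maximum points of \<open>\<phi>\<close> on the deformed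
  disk, then moving along finitely many coordinates of the gradient lowers the maximum at a rate of
  at least \<open>\<epsilon> / 16\<close> per unit of displacement. Finitely many coordinates suffice, because the maximum
  points are weakly compact; truncating the gradient where it is small keeps the direction defined
  and weakly continuous on the whole disk.

By linking, the maximal level of \<open>\<phi>\<close> on a deformed disk is at least \<open>C + 1\<close>. Ekeland's principle gives an
\<open>h\<close> whose level cannot be lowered at the rate \<open>\<epsilon> / 16\<close>, so by the third fact some maximum point on
its deformed disk is almost critical.\<close>

section \<open>Mod 2 chains on the integer grid\<close>

lemma bit_double [simp]: "(x::bit) + x = 0"
  by (cases x) auto

lemma bit_double_left [simp]: "(x::bit) + (x + y) = y"
  by (cases x; cases y) auto

lemma bit_add_eq_0_iff: "x + y = 0 \<longleftrightarrow> x = (y::bit)"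
  by (cases x; cases y) auto

declare add_bit_eq_xor [simp del] mult_bit_eq_and [simp del]

text \<open>Chains with coefficients modulo 2 appear only through their pairing with cochains, that is, with
functions from lists of vertices to \<open>bit\<close>. Here \<open>on_boundary s g\<close> is \<open>g\<close> evaluated on the boundary
of the simplex \<open>s\<close>, and \<open>on_prism a c s g\<close> is \<open>g\<close> evaluated on the standard triangulation of the prism with
bottom \<open>map a s\<close> and top \<open>map c s\<close>. Working with functionals avoids all geometry: only the identities
of the boundary operator are used, and degenerate simplices do no harm.\<close>

primrec on_boundary :: "'v list \<Rightarrow> ('v list \<Rightarrow> bit) \<Rightarrow> bit" where
  "on_boundary [] g = 0"
| "on_boundary (v # s) g = g s + on_boundary s (\<lambda>t. g (v # t))"

primrec on_prism :: "('v \<Rightarrow> 'w) \<Rightarrow> ('v \<Rightarrow> 'w) \<Rightarrow> 'v list \<Rightarrow> ('w list \<Rightarrow> bit) \<Rightarrow> bit" where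
  "on_prism a c [] g = 0"
| "on_prism a c (v # s) g = g (a v # map c (v # s)) + on_prism a c s (\<lambda>t. g (a v # t))"

lemma on_boundary_add:
  "on_boundary s (\<lambda>t. g t + h t) = on_boundary s g + on_boundary s h"
  by (induction s arbitrary: g h) (simp_all add: ac_simps)

lemma on_boundary_zero: "on_boundary s (\<lambda>t. 0) = 0"
  by (induction s) simp_all

lemma on_prism_add:
  "on_prism a c s (\<lambda>t. g t + h t) = on_prism a c s g + on_prism a c s h"
  by (induction s arbitrary: g h) (simp_all add: ac_simps)

lemma on_boundary_map:
  "on_boundary (map a s) g = on_boundary s (\<lambda>t. g (map a t))"
  by (induction s arbitrary: g) simp_all

lemma on_boundary_cong:
  assumes "\<And>t. length s = Suc (length t) \<Longrightarrow> set t \<subseteq> set s \<Longrightarrow> g t = h t"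
  shows "on_boundary s g = on_boundary s h"
  using assms
proof (induction s arbitrary: g h)
  case (Cons v s)
  have "on_boundary s (\<lambda>t. g (v # t)) = on_boundary s (\<lambda>t. h (v # t))"
    by (rule Cons.IH, rule Cons.prems) auto
  moreover have "g s = h s" by (rule Cons.prems) auto
  ultimately show ?case by simp
qed simp

lemma on_boundary_twice: "on_boundary s (\<lambda>t. on_boundary t g) = 0"
proof (induction s arbitrary: g)
  case (Cons v s)
  then show ?case by (simp add: on_boundary_add)
qed simp

text \<open>The prism is a chain homotopy between its bottom and its top.\<close>

lemma on_prism_boundary:
  "on_prism a c s (\<lambda>t. on_boundary t g) =
     g (map c s) + g (map a s) + on_boundary s (\<lambda>t. on_prism a c t g)"
proof (induction s arbitrary: g)
  case (Cons v s)
  then show ?case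
    by (simp add: on_prism_add on_boundary_add on_boundary_map ac_simps)
qed simp

lemma on_prism_cong:
  assumes "\<And>i. i < length s \<Longrightarrow>
     g (map a (take (Suc i) s) @ map c (drop i s)) = h (map a (take (Suc i) s) @ map c (drop i s))"
  shows "on_prism a c s g = on_prism a c s h"
  using assms
proof (induction s arbitrary: g h)
  case (Cons v s)
  have "on_prism a c s (\<lambda>t. g (a v # t)) = on_prism a c s (\<lambda>t. h (a v # t))"
  proof (rule Cons.IH)
    fix i assume "i < length s"
    then show "g (a v # map a (take (Suc i) s) @ map c (drop i s)) =
               h (a v # map a (take (Suc i) s) @ map c (drop i s))"
      using Cons.prems[of "Suc i"] by simp
  qed
  moreover have "g (a v # map c (v # s)) = h (a v # map c (v # s))"
    using Cons.prems[of 0] by simp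
  ultimately show ?case by simp
qed simp

lemma on_prism_zero: "on_prism a c s (\<lambda>t. 0) = 0"
  by (induction s) simp_all

definition antipode :: "(nat \<Rightarrow> int) \<Rightarrow> nat \<Rightarrow> int" where
  "antipode v = (\<lambda>i. - v i)"

lemma antipode_antipode [simp]: "antipode (antipode v) = v"
  by (simp add: antipode_def)

lemma antipode_comp_antipode [simp]: "antipode \<circ> antipode = id"
  by (rule ext) simp

text \<open>A triangulated grid of dimension \<open>j\<close>, again as a functional on cochains. The slab
\<open>0 \<le> v j \<le> T\<close> is a stack of \<open>T\<close> prisms over the grid of dimension \<open>j\<close>, and the grid of the next
dimension is this slab together with its antipodal image. Hence antipodal symmetry holds by
construction.\<close>

primrec on_grid :: "nat \<Rightarrow> nat \<Rightarrow> ((nat \<Rightarrow> int) list \<Rightarrow> bit) \<Rightarrow> bit" where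
  "on_grid T 0 g = g [\<lambda>_. 0]"
| "on_grid T (Suc j) g =
     (\<Sum>t<T. on_grid T j (\<lambda>s. on_prism (\<lambda>v. v(j := int t)) (\<lambda>v. v(j := int t + 1)) s
        (\<lambda>s. g s + g (map antipode s))))"

text \<open>Its boundary at height \<open>0\<close> is the grid one dimension lower.\<close>

definition on_half :: "nat \<Rightarrow> nat \<Rightarrow> ((nat \<Rightarrow> int) list \<Rightarrow> bit) \<Rightarrow> bit" where
  "on_half T j g =
     (\<Sum>t<T. on_grid T j (\<lambda>s. on_prism (\<lambda>v. v(j := int t)) (\<lambda>v. v(j := int t + 1)) s g))"

lemma on_grid_Suc: "on_grid T (Suc j) g = on_half T j (\<lambda>s. g s + g (map antipode s))"
  by (simp add: on_half_def)

declare on_grid.simps(2) [simp del]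

lemma on_grid_add:
  "on_grid T j (\<lambda>s. g s + h s) = on_grid T j g + on_grid T j h"
proof (induction j arbitrary: g h)
  case (Suc j)
  have "(\<lambda>s. g s + h s + (g (map antipode s) + h (map antipode s))) =
     (\<lambda>s. (g s + g (map antipode s)) + (h s + h (map antipode s)))"
    by (simp add: ac_simps)
  then show ?case
    by (simp add: on_grid.simps on_prism_add Suc sum.distrib ac_simps)
qed simp

lemma on_grid_antipode: "on_grid T j (\<lambda>s. g (map antipode s)) = on_grid T j g"
proof (cases j)
  case 0
  have "antipode (\<lambda>_. 0) = (\<lambda>_. 0)" by (simp add: antipode_def)
  then show ?thesis by (simp add: 0)
next
  case (Suc i)
  then show ?thesis by (simp add: on_grid_Suc add.commute)
qed

text \<open>What the simplices of the grid are known to satisfy: they live in the first \<open>j\<close> coordinates and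
have diameter at most 1 in the maximum norm.\<close>

definition small_simplex :: "nat \<Rightarrow> (nat \<Rightarrow> int) list \<Rightarrow> bool" where
  "small_simplex j s \<longleftrightarrow> length s = Suc j \<and> (\<forall>v\<in>set s. \<forall>i\<ge>j. v i = 0) \<and>
     (\<forall>v\<in>set s. \<forall>w\<in>set s. \<forall>i. \<bar>v i - w i\<bar> \<le> 1)"

lemma small_simplex_prism:
  assumes "small_simplex j s" "i < length s"
  shows "small_simplex (Suc j)
     (map (\<lambda>v. v(j := int t)) (take (Suc i) s) @ map (\<lambda>v. v(j := int t + 1)) (drop i s))"
  using assms set_take_subset[of "Suc i" s] set_drop_subset[of i s]
  unfolding small_simplex_def
  by (auto simp: subset_iff)

lemma small_simplex_antipode: "small_simplex j (map antipode s) = small_simplex j s"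
proof -
  have "\<bar>w - v\<bar> = \<bar>v - w\<bar>" for v w :: int by simp
  then show ?thesis by (auto simp: small_simplex_def antipode_def)
qed

text \<open>Cochains that agree on small simplices have the same value on the grid, so the triangulation never
has to be described further.\<close>

lemma on_grid_cong:
  assumes "\<And>s. small_simplex j s \<Longrightarrow> g s = h s"
  shows "on_grid T j g = on_grid T j h"
  using assms
proof (induction j arbitrary: g h)
  case 0
  then show ?case by (simp add: small_simplex_def)
next
  case (Suc j)
  show ?case unfolding on_grid.simps
    by (intro sum.cong refl Suc.IH on_prism_cong arg_cong2[where f="(+)"] Suc.prems)
       (auto simp del: map_append simp: small_simplex_antipode intro: small_simplex_prism)
qed

lemma on_half_cong:
  assumes "\<And>s. small_simplex (Suc j) s \<Longrightarrow> g s = h s"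
  shows "on_half T j g = on_half T j h"
  unfolding on_half_def
  by (intro sum.cong refl on_grid_cong on_prism_cong assms small_simplex_prism) auto

lemma on_grid_zero: "on_grid T j (\<lambda>s. 0) = 0"
  using on_grid_add[of T j "\<lambda>s. 0" "\<lambda>s. 0"] by simp

text \<open>The grid is cut off at height \<open>T\<close>, where it has an artificial boundary. Only cochains that vanish there
are evaluated.\<close>

definition vanishes_far :: "nat \<Rightarrow> nat \<Rightarrow> ((nat \<Rightarrow> int) list \<Rightarrow> bit) \<Rightarrow> bool" where
  "vanishes_far T j g \<longleftrightarrow> (\<forall>s. (\<exists>v\<in>set s. \<exists>i<j. \<bar>v i\<bar> \<ge> int T) \<longrightarrow> g s = 0)"

lemma vanishes_far_antipode:
  "vanishes_far T j g \<Longrightarrow> vanishes_far T j (\<lambda>s. g (map antipode s))"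
  unfolding vanishes_far_def by (simp add: antipode_def)

lemma vanishes_far_prism:
  assumes "vanishes_far T (Suc j) g"
  shows "vanishes_far T j (\<lambda>r. on_prism (\<lambda>v. v(j := t)) (\<lambda>v. v(j := t')) r g)"
  unfolding vanishes_far_def
proof (intro allI impI)
  fix r :: "(nat \<Rightarrow> int) list"
  assume "\<exists>v\<in>set r. \<exists>i<j. \<bar>v i\<bar> \<ge> int T"
  then obtain v i where v: "v \<in> set r" "i < j" "\<bar>v i\<bar> \<ge> int T" by blast
  have "on_prism (\<lambda>v. v(j := t)) (\<lambda>v. v(j := t')) r g =
        on_prism (\<lambda>v. v(j := t)) (\<lambda>v. v(j := t')) r (\<lambda>_. 0)"
  proof (rule on_prism_cong)
    fix k assume k: "k < length r"
    let ?l = "map (\<lambda>v. v(j := t)) (take (Suc k) r) @ map (\<lambda>v. v(j := t')) (drop k r)"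
    have "set r = set (take k r) \<union> set (drop k r)"
      by (metis append_take_drop_id set_append)
    then have "set r \<subseteq> set (take (Suc k) r) \<union> set (drop k r)"
      using set_take_subset_set_take[of k "Suc k" r] by auto
    then have "v(j := t) \<in> set ?l \<or> v(j := t') \<in> set ?l"
      using v(1) by auto
    then have "\<exists>v\<in>set ?l. \<exists>i<Suc j. \<bar>v i\<bar> \<ge> int T"
    proof
      assume "v(j := t) \<in> set ?l"
      then show ?thesis by (rule bexI[rotated]) (use v in auto)
    next
      assume "v(j := t') \<in> set ?l"
      then show ?thesis by (rule bexI[rotated]) (use v in auto)
    qed
    then show "g ?l = 0"
      using assms unfolding vanishes_far_def by blast
  qed
  then show "on_prism (\<lambda>v. v(j := t)) (\<lambda>v. v(j := t')) r g = 0"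
    by (simp add: on_prism_zero)
qed

lemma sum_telescope_bit:
  "(\<Sum>t<T. f (Suc t) + f t) = f T + (f 0 :: bit)"
  by (induction T) (auto simp: ac_simps)

text \<open>In the sum over the layers the bottoms and tops telescope, the top layer is out of reach of \<open>g\<close>, and
the lateral contributions vanish because the lower-dimensional grid is a cycle.\<close>

lemma on_half_boundary_if_cycle:
  assumes g: "vanishes_far T (Suc j) g"
    and cyc: "\<And>g. vanishes_far T j g \<Longrightarrow> g [] = 0 \<Longrightarrow> on_grid T j (\<lambda>s. on_boundary s g) = 0"
  shows "on_half T j (\<lambda>s. on_boundary s g) = on_grid T j g"
proof -
  let ?f = "\<lambda>t. on_grid T j (\<lambda>s. g (map (\<lambda>v. v(j := int t)) s))"
  have cyc': "on_grid T j (\<lambda>s. on_boundary s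
      (\<lambda>r. on_prism (\<lambda>v. v(j := t)) (\<lambda>v. v(j := t')) r g)) = 0" for t t'
    by (intro cyc vanishes_far_prism g) simp
  have "on_half T j (\<lambda>s. on_boundary s g) = (\<Sum>t<T. ?f (Suc t) + ?f t)"
    unfolding on_half_def on_prism_boundary on_grid_add
    by (rule sum.cong) (auto simp: cyc' add.commute)
  also have "\<dots> = ?f T + ?f 0" by (rule sum_telescope_bit)
  also have "?f T = on_grid T j (\<lambda>s. 0)"
  proof (rule on_grid_cong)
    fix s assume "small_simplex j s"
    then obtain v where v: "v \<in> set s" by (cases s) (auto simp: small_simplex_def)
    then have "v(j := int T) \<in> set (map (\<lambda>v. v(j := int T)) s)" by simp
    then have "\<exists>v\<in>set (map (\<lambda>v. v(j := int T)) s). \<exists>i<Suc j. \<bar>v i\<bar> \<ge> int T"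
      by (rule bexI[rotated]) auto
    then show "g (map (\<lambda>v. v(j := int T)) s) = 0"
      using g unfolding vanishes_far_def by blast
  qed
  also have "?f 0 = on_grid T j g"
  proof (rule on_grid_cong)
    fix s assume "small_simplex j s"
    then have "map (\<lambda>v. v(j := int 0)) s = s"
      by (intro map_idI) (auto simp: small_simplex_def)
    then show "g (map (\<lambda>v. v(j := int 0)) s) = g s" by simp
  qed
  finally show ?thesis by (simp add: on_grid_zero)
qed

text \<open>The boundary of the grid is the boundary of the upper half plus its antipode, that is, twice a grid of
lower dimension.\<close>

lemma on_grid_boundary:
  "vanishes_far T j g \<Longrightarrow> g [] = 0 \<Longrightarrow> on_grid T j (\<lambda>s. on_boundary s g) = 0"
proof (induction j arbitrary: g)
  case (Suc j)
  let ?h = "\<lambda>s. g s + g (map antipode s)"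
  have h: "vanishes_far T (Suc j) ?h"
    using Suc.prems(1) vanishes_far_antipode[OF Suc.prems(1)] by (simp add: vanishes_far_def)
  have "on_grid T (Suc j) (\<lambda>s. on_boundary s g) = on_half T j (\<lambda>s. on_boundary s ?h)"
    by (simp add: on_grid_Suc on_boundary_add on_boundary_map)
  also have "\<dots> = on_grid T j ?h"
    using h Suc.IH by (rule on_half_boundary_if_cycle)
  also have "\<dots> = 0"
    by (simp add: on_grid_add on_grid_antipode)
  finally show ?case .
qed simp

lemma on_half_boundary:
  "vanishes_far T (Suc j) g \<Longrightarrow> on_half T j (\<lambda>s. on_boundary s g) = on_grid T j g"
  by (rule on_half_boundary_if_cycle) (auto intro: on_grid_boundary)

section \<open>Alternating sign sequences and the cochain of Ky Fan\<close>

primrec alternates :: "bool \<Rightarrow> int list \<Rightarrow> bit" where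
  "alternates b [] = 1"
| "alternates b (x # l) = (if (x > 0) = b then alternates (\<not> b) l else 0)"

text \<open>An alternating sequence has exactly one facet alternating from \<open>b\<close>, obtained by deleting its first or
its last sign. Any other sequence with such a facet repeats one sign, and deleting either copy gives
an alternating facet; modulo 2 the two cancel.\<close>

lemma on_boundary_alternates:
  "on_boundary l (alternates b) + (alternates b l + alternates (\<not> b) l) = 0"
proof (induction l arbitrary: b)
  case (Cons x l)
  have "on_boundary l (alternates (\<not> b)) = alternates (\<not> b) l + alternates b l"
    using Cons.IH[of "\<not> b"] by (simp add: bit_add_eq_0_iff)
  then show ?case
    by (auto simp: on_boundary_zero ac_simps)
qed simp

lemma alternates_uminus:
  "0 \<notin> set l \<Longrightarrow> alternates b (map uminus l) = alternates (\<not> b) l"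
proof (induction l arbitrary: b)
  case (Cons x l)
  then have "(- x > 0) = (\<not> x > 0)" by auto
  then show ?case using Cons by auto
qed simp

text \<open>Deleting an entry commutes with sorting up to the order in which the entries are listed; the boundary
of a symmetric cochain can therefore be computed on the sorted list.\<close>

lemma on_boundary_insort_abs:
  fixes l :: "int list"
  assumes "sorted (map abs l)"
  shows "on_boundary (insort_key abs x l) g = g l + on_boundary l (\<lambda>t. g (insort_key abs x t))"
  using assms
proof (induction l arbitrary: g)
  case (Cons y l)
  show ?case
  proof (cases "\<bar>x\<bar> \<le> \<bar>y\<bar>")
    case True
    have "on_boundary l (\<lambda>t. g (x # y # t)) = on_boundary l (\<lambda>t. g (insort_key abs x (y # t)))"
      using True by simp
    moreover have "g (x # l) = g (insort_key abs x l)"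
      using True Cons.prems by (cases l) auto
    ultimately show ?thesis using True by (simp add: ac_simps)
  next
    case False
    then show ?thesis using Cons by (simp add: ac_simps)
  qed
qed simp

lemma on_boundary_sort_abs:
  fixes l :: "int list"
  shows "on_boundary l (\<lambda>t. g (sort_key abs t)) = on_boundary (sort_key abs l) g"
proof (induction l arbitrary: g)
  case (Cons x l)
  then show ?case by (simp add: on_boundary_insort_abs)
qed simp

lemma sort_abs_uminus:
  fixes l :: "int list"
  shows "sort_key abs (map uminus l) = map uminus (sort_key abs l)"
proof (induction l)
  case (Cons x l)
  have "insort_key abs (- x) (map uminus l) = map uminus (insort_key abs x l)" for l :: "int list"
    by (induction l) auto
  then show ?case by (simp add: Cons)
qed simp

text \<open>The cochain of Ky Fan: the labels, ordered by absolute value, alternate in sign and start with a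
positive one. Its value is meaningful only for lists without
complementary labels \<open>x\<close> and \<open>- x\<close>.\<close>

definition ky_fan :: "int list \<Rightarrow> bit" where
  "ky_fan l = alternates True (sort_key abs l)"

lemma ky_fan_Nil: "ky_fan [] = 1"
  by (simp add: ky_fan_def)

text \<open>The key identity of Ky Fan's lemma: without complementary labels, the coboundary of the cochain is the
sum of the cochain and its antipode.\<close>

lemma on_boundary_ky_fan:
  assumes "\<And>x. x \<in> set l \<Longrightarrow> - x \<notin> set l"
  shows "on_boundary l ky_fan = ky_fan l + ky_fan (map uminus l)"
proof -
  have "0 \<notin> set (sort_key abs l)" using assms[of 0] by auto
  then have "ky_fan (map uminus l) = alternates False (sort_key abs l)"
    by (simp add: ky_fan_def sort_abs_uminus alternates_uminus)
  moreover have "on_boundary l ky_fan = on_boundary (sort_key abs l) (alternates True)"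
    by (simp add: ky_fan_def[abs_def] on_boundary_sort_abs)
  ultimately show ?thesis
    using on_boundary_alternates[of "sort_key abs l" True]
    by (simp add: ky_fan_def bit_add_eq_0_iff)
qed

lemma alternates_repeat: "alternates b (xs @ x # x # ys) = 0"
  by (induction xs arbitrary: b) auto

text \<open>With only \<open>m\<close> absolute values at hand, a longer list repeats one of them. The two labels are then
equal, since they are not complementary, and adjacent after sorting.\<close>

lemma ky_fan_too_long:
  assumes "\<And>x. x \<in> set l \<Longrightarrow> - x \<notin> set l" "\<And>x. x \<in> set l \<Longrightarrow> \<bar>x\<bar> \<le> int m" "m < length l"
  shows "ky_fan l = 0"
proof -
  let ?s = "sort_key abs l"
  have "\<not> distinct (map abs ?s)"
  proof
    assume "distinct (map abs ?s)"
    then have "length l = card (abs ` set l)"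
      using distinct_card[of "map abs ?s"] by simp
    moreover have "abs ` set l \<subseteq> {1..int m}"
    proof
      fix y assume "y \<in> abs ` set l"
      then obtain x where x: "x \<in> set l" "y = \<bar>x\<bar>" by blast
      then have "x \<noteq> 0" using assms(1)[of x] by auto
      then show "y \<in> {1..int m}" using x assms(2)[of x] by auto
    qed
    then have "card (abs ` set l) \<le> m"
      using card_mono[of "{1..int m}"] by fastforce
    ultimately show False using assms(3) by simp
  qed
  then have "\<not> sorted_wrt (<) (map abs ?s)"
    using strict_sorted_iff by blast
  then obtain i where i: "Suc i < length ?s" "\<not> \<bar>?s ! i\<bar> < \<bar>?s ! Suc i\<bar>"
    by (auto simp: sorted_wrt_iff_nth_Suc_transp[OF transp_on_less])
  have "\<bar>?s ! i\<bar> \<le> \<bar>?s ! Suc i\<bar>"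
    using sorted_nth_mono[OF sorted_sort_key, of i "Suc i" abs l] i(1) by simp
  then have "\<bar>?s ! i\<bar> = \<bar>?s ! Suc i\<bar>" using i(2) by simp
  moreover have "?s ! i \<in> set l" "?s ! Suc i \<in> set l"
    using i(1) nth_mem[of i ?s] nth_mem[of "Suc i" ?s] by auto
  ultimately have eq: "?s ! i = ?s ! Suc i"
    using assms(1) by (metis abs_eq_iff)
  have "?s = take i ?s @ ?s ! i # ?s ! Suc i # drop (Suc (Suc i)) ?s"
    using id_take_nth_drop[of i ?s] Cons_nth_drop_Suc[OF i(1)] i(1) by simp
  then have "alternates True ?s = alternates True (take i ?s @ ?s ! i # ?s ! i # drop (Suc (Suc i)) ?s)"
    using eq by simp
  then show ?thesis
    by (simp only: ky_fan_def alternates_repeat)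
qed

text \<open>A Tucker lemma for a symmetric set \<open>U\<close> of grid points around the origin. Suppose that no small simplex
crossing the boundary of \<open>U\<close> carries complementary labels. Let \<open>a\<^sub>j\<close> be the number modulo 2 of
positive alternating simplices in the boundary of the part of \<open>U\<close> of dimension \<open>j\<close>, including the
empty simplex for \<open>j = 0\<close>. Splitting into upper and lower half and using Ky Fan's identity gives
\<open>a\<^sub>j\<^sub>+\<^sub>1 = a\<^sub>j\<close>, and \<open>a\<^sub>0 = 1\<close> because the origin lies in \<open>U\<close>. In dimension \<open>m + 1\<close> there are too few labels for
an alternating simplex on the boundary, a contradiction.\<close>

lemma combinatorial_borsuk:
  fixes lab :: "(nat \<Rightarrow> int) \<Rightarrow> int" and U :: "(nat \<Rightarrow> int) set"
  assumes odd: "\<And>v. lab (antipode v) = - lab v"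
    and bound: "\<And>v. \<bar>lab v\<bar> \<le> int m"
    and sym: "\<And>v. v \<in> U \<Longrightarrow> antipode v \<in> U"
    and origin: "(\<lambda>_. 0) \<in> U"
    and bdd: "\<And>v i. v \<in> U \<Longrightarrow> i \<le> m \<Longrightarrow> \<bar>v i\<bar> < int T"
  obtains s where "\<And>v i. v \<in> set s \<Longrightarrow> i > m \<Longrightarrow> v i = 0"
    and "\<And>v w i. v \<in> set s \<Longrightarrow> w \<in> set s \<Longrightarrow> \<bar>v i - w i\<bar> \<le> 1"
    and "\<not> set s \<subseteq> U" "set s \<inter> U \<noteq> {}"
    and "\<exists>v\<in>set s. \<exists>w\<in>set s. lab w = - lab v"
proof (rule ccontr)
  assume contra: "\<not> thesis"
  note found = that
  define compl where "compl s \<longleftrightarrow> (\<exists>v\<in>set s. \<exists>w\<in>set s. lab w = - lab v)" for s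
  \<comment> \<open>Small simplices with complementary labels do not cross the boundary of \<open>U\<close>.\<close>
  have dichotomy: "set s \<subseteq> U \<or> set s \<inter> U = {}"
    if "small_simplex j s" "j \<le> Suc m" "compl s" for j s
  proof (rule ccontr)
    assume not: "\<not> ?thesis"
    show False
    proof (rule notE[OF contra], rule found)
      show "v i = 0" if "v \<in> set s" "i > m" for v i
        using \<open>small_simplex j s\<close> \<open>j \<le> Suc m\<close> that by (simp add: small_simplex_def)
      show "\<bar>v i - w i\<bar> \<le> 1" if "v \<in> set s" "w \<in> set s" for v w i
        using \<open>small_simplex j s\<close> that by (simp add: small_simplex_def)
    qed (use not \<open>compl s\<close> in \<open>auto simp: compl_def\<close>)
  qed
  define inside :: "(nat \<Rightarrow> int) list \<Rightarrow> bit" where "inside s = of_bool (set s \<subseteq> U)" for s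
  define p where "p s = ky_fan (map lab s)" for s
  define q where "q s = p s + p (map antipode s)" for s
  \<comment> \<open>The defect of Ky Fan's identity, supported on simplices with complementary labels.\<close>
  define e where "e s = q s + on_boundary s p" for s
  have symU: "antipode v \<in> U \<longleftrightarrow> v \<in> U" for v
    using sym[of v] sym[of "antipode v"] by auto
  have inside_antipode: "inside (map antipode s) = inside s" for s
    by (auto simp: inside_def symU subset_iff)
  have no_compl: "- x \<notin> set (map lab s)" if x: "x \<in> set (map lab s)" "\<not> compl s" for x s
  proof
    assume "- x \<in> set (map lab s)"
    then obtain w where "w \<in> set s" "- x = lab w" unfolding set_map by blast
    moreover obtain v where "v \<in> set s" "x = lab v" using x(1) unfolding set_map by blast
    ultimately have "compl s" unfolding compl_def by (intro bexI[of _ v] bexI[of _ w]) simp_all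
    with x(2) show False ..
  qed
  have e_zero: "e s = 0" if "\<not> compl s" for s
  proof -
    have "lab \<circ> antipode = uminus \<circ> lab" using odd by auto
    moreover have "on_boundary s p = on_boundary (map lab s) ky_fan"
      by (simp add: p_def[abs_def] on_boundary_map)
    moreover have "on_boundary (map lab s) ky_fan = ky_fan (map lab s) + ky_fan (map uminus (map lab s))"
    proof (rule on_boundary_ky_fan)
      fix x assume "x \<in> set (map lab s)"
      then show "- x \<notin> set (map lab s)" using that by (rule no_compl)
    qed
    ultimately show ?thesis
      by (simp add: e_def q_def p_def)
  qed
  have compl_mono: "compl t \<Longrightarrow> set t \<subseteq> set s \<Longrightarrow> compl s" for s t
    unfolding compl_def by blast
  \<comment> \<open>Restriction to \<open>U\<close> commutes with the coboundary, for cochains living on complementary simplices.\<close>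
  have cut: "on_boundary s (\<lambda>t. inside t * g t) = inside s * on_boundary s g"
    if s: "small_simplex (Suc j) s" "j \<le> m"
      and g: "\<And>t. length t = Suc j \<Longrightarrow> \<not> compl t \<Longrightarrow> g t = 0" for j s g
  proof (cases "set s \<subseteq> U")
    case True
    then have "on_boundary s (\<lambda>t. inside t * g t) = on_boundary s g"
      by (intro on_boundary_cong) (auto simp: inside_def)
    then show ?thesis using True by (simp add: inside_def)
  next
    case False
    have "on_boundary s (\<lambda>t. inside t * g t) = on_boundary s (\<lambda>t. 0)"
    proof (rule on_boundary_cong)
      fix t assume t: "length s = Suc (length t)" "set t \<subseteq> set s"
      then have len: "length t = Suc j" using s by (simp add: small_simplex_def)
      show "inside t * g t = 0"
      proof (cases "compl t \<and> set t \<subseteq> U")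
        case True
        then have "set s \<inter> U = {}"
          using dichotomy[OF s(1)] s(2) compl_mono[OF _ t(2)] False by auto
        moreover have "set t \<subseteq> set s \<inter> U" using True t(2) by simp
        ultimately have "set t = {}" by simp
        then show ?thesis using len by simp
      next
        case False
        then show ?thesis using g[OF len] by (auto simp: inside_def)
      qed
    qed
    then show ?thesis using False by (simp add: inside_def on_boundary_zero)
  qed
  have far: "vanishes_far T (Suc j) (\<lambda>s. inside s * g s)" if "j \<le> m" for j g
    unfolding vanishes_far_def
  proof (intro allI impI)
    fix s :: "(nat \<Rightarrow> int) list"
    assume "\<exists>v\<in>set s. \<exists>i<Suc j. int T \<le> \<bar>v i\<bar>"
    then obtain v i where "v \<in> set s" "i < Suc j" "int T \<le> \<bar>v i\<bar>" by blast
    then have "\<not> set s \<subseteq> U" using bdd[of v i] that by auto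
    then show "inside s * g s = 0" by (simp add: inside_def)
  qed
  have step: "on_grid T (Suc j) (\<lambda>s. inside s * on_boundary s p) =
              on_grid T j (\<lambda>s. inside s * on_boundary s p)" if j: "j \<le> m" for j
  proof -
    have "on_grid T (Suc j) (\<lambda>s. inside s * on_boundary s p) =
          on_half T j (\<lambda>s. inside s * on_boundary s q)"
      by (simp add: on_grid_Suc inside_antipode q_def[abs_def] on_boundary_add on_boundary_map
          algebra_simps)
    also have "\<dots> = on_half T j (\<lambda>s. inside s * on_boundary s e)"
      by (simp add: e_def[abs_def] on_boundary_add on_boundary_twice)
    also have "\<dots> = on_half T j (\<lambda>s. on_boundary s (\<lambda>t. inside t * e t))"
      by (rule on_half_cong, rule cut[symmetric]) (use j e_zero in auto)
    also have "\<dots> = on_grid T j (\<lambda>s. inside s * e s)"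
      by (rule on_half_boundary) (rule far[OF j])
    also have "\<dots> = on_grid T j (\<lambda>s. inside s * p s + inside (map antipode s) * p (map antipode s))
                      + on_grid T j (\<lambda>s. inside s * on_boundary s p)"
      by (simp add: e_def q_def on_grid_add inside_antipode algebra_simps)
    also have "\<dots> = on_grid T j (\<lambda>s. inside s * on_boundary s p)"
      by (simp add: on_grid_add on_grid_antipode[where g = "\<lambda>s. inside s * p s"])
    finally show ?thesis .
  qed
  have one: "on_grid T j (\<lambda>s. inside s * on_boundary s p) = 1" if "j \<le> Suc m" for j
    using that
  proof (induction j)
    case 0
    then show ?case using origin by (simp add: inside_def p_def ky_fan_Nil)
  next
    case (Suc j)
    then show ?case using step[of j] by simp
  qed
  have "on_grid T (Suc m) (\<lambda>s. inside s * on_boundary s p) =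
        on_grid T (Suc m) (\<lambda>s. on_boundary s (\<lambda>t. if t = [] then 0 else inside t * p t))"
  proof (rule on_grid_cong)
    fix s assume s: "small_simplex (Suc m) s"
    have "inside s * on_boundary s p = on_boundary s (\<lambda>t. inside t * p t)"
    proof (rule cut[OF s, symmetric])
      fix t assume t: "length t = Suc m" "\<not> compl t"
      show "p t = 0" unfolding p_def
      proof (rule ky_fan_too_long[where m = m])
        fix x assume "x \<in> set (map lab t)"
        then show "- x \<notin> set (map lab t)" using t(2) by (rule no_compl)
        show "\<bar>x\<bar> \<le> int m" using \<open>x \<in> set (map lab t)\<close> bound by auto
      qed (simp add: t(1))
    qed simp
    also have "\<dots> = on_boundary s (\<lambda>t. if t = [] then 0 else inside t * p t)"
      by (rule on_boundary_cong) (use s in \<open>auto simp: small_simplex_def\<close>)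
    finally show "inside s * on_boundary s p = \<dots>" .
  qed
  also have "\<dots> = 0"
  proof (rule on_grid_boundary)
    show "vanishes_far T (Suc m) (\<lambda>t. if t = [] then 0 else inside t * p t)"
      using far[of m p] unfolding vanishes_far_def by simp
  qed simp
  finally show False using one[of "Suc m"] by simp
qed

section \<open>A Borsuk theorem for symmetric neighbourhoods of the origin\<close>

lemma compact_coordinate_box:
  fixes c :: "nat \<Rightarrow> 'a::real_normed_vector"
  shows "compact {\<Sum>i<n. a i *\<^sub>R c i | a. \<forall>i<n. \<bar>a i\<bar> \<le> R}"
proof (induction n)
  case 0
  have "{\<Sum>i<0. a i *\<^sub>R c i | a. \<forall>i<0. \<bar>a i\<bar> \<le> R} = {0 :: 'a}" by auto
  then show ?case by simp
next
  case (Suc n)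
  let ?K = "{\<Sum>i<n. a i *\<^sub>R c i | a. \<forall>i<n. \<bar>a i\<bar> \<le> R}"
  have "{\<Sum>i<Suc n. a i *\<^sub>R c i | a. \<forall>i<Suc n. \<bar>a i\<bar> \<le> R} =
        (\<lambda>(x, t). x + t *\<^sub>R c n) ` (?K \<times> {-R..R})" (is "?L = ?M")
  proof
    show "?L \<subseteq> ?M"
    proof clarify
      fix a assume a: "\<forall>i<Suc n. \<bar>a i\<bar> \<le> R"
      then have "\<bar>a n\<bar> \<le> R" "\<forall>i<n. \<bar>a i\<bar> \<le> R" by simp_all
      then have "(\<Sum>i<n. a i *\<^sub>R c i) \<in> ?K"
        by (intro CollectI exI[of _ a]) simp
      moreover have "a n \<in> {-R..R}"
        unfolding atLeastAtMost_iff using \<open>\<bar>a n\<bar> \<le> R\<close> by linarith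
      ultimately have "(\<Sum>i<n. a i *\<^sub>R c i, a n) \<in> ?K \<times> {-R..R}" by (rule SigmaI)
      then show "(\<Sum>i<Suc n. a i *\<^sub>R c i) \<in> ?M"
        by (rule image_eqI[rotated]) simp
    qed
    show "?M \<subseteq> ?L"
    proof clarify
      fix a t assume a: "\<forall>i<n. \<bar>a i\<bar> \<le> R" and t: "t \<in> {-R..R}"
      have "(\<Sum>i<n. a i *\<^sub>R c i) + t *\<^sub>R c n = (\<Sum>i<Suc n. (a(n := t)) i *\<^sub>R c i)"
        by simp
      moreover have "\<forall>i<Suc n. \<bar>(a(n := t)) i\<bar> \<le> R" using a t by auto
      ultimately show "\<exists>a'. (\<Sum>i<n. a i *\<^sub>R c i) + t *\<^sub>R c n = (\<Sum>i<Suc n. a' i *\<^sub>R c i) \<and>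
          (\<forall>i<Suc n. \<bar>a' i\<bar> \<le> R)" by (intro exI[of _ "a(n := t)"] conjI)
    qed
  qed
  moreover have "continuous_on (?K \<times> {-R..R}) (\<lambda>(x, t). x + t *\<^sub>R c n)"
    by (auto simp: case_prod_unfold intro!: continuous_intros)
  ultimately show ?case
    using Suc by (auto intro!: compact_continuous_image compact_Times)
qed

lemma dominant_index:
  fixes y :: "nat \<Rightarrow> real"
  obtains i where "i \<le> m" "\<And>l. l < m \<Longrightarrow> \<bar>y l\<bar> \<le> \<bar>y i\<bar>" "m > 0 \<Longrightarrow> i < m"
proof (cases "m = 0")
  case False
  then have "Max ((\<lambda>l. \<bar>y l\<bar>) ` {..<m}) \<in> (\<lambda>l. \<bar>y l\<bar>) ` {..<m}"
    by (intro Max_in) auto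
  then obtain i where i: "i < m" "Max ((\<lambda>l. \<bar>y l\<bar>) ` {..<m}) = \<bar>y i\<bar>" by auto
  then have "\<bar>y l\<bar> \<le> \<bar>y i\<bar>" if "l < m" for l
    using Max_ge[of "(\<lambda>l. \<bar>y l\<bar>) ` {..<m}" "\<bar>y l\<bar>"] that by auto
  then show ?thesis using that i by auto
qed (use that in auto)

text \<open>Indices are shifted by 1, so that every nonzero vector has a nonzero label and opposite vectors have
opposite labels; the label 0 is left for the zero vector.\<close>

definition dominant_label :: "nat \<Rightarrow> (nat \<Rightarrow> real) \<Rightarrow> int" where
  "dominant_label m y =
     (let i = (LEAST i. \<forall>l<m. \<bar>y l\<bar> \<le> \<bar>y i\<bar>)
      in if i < m then (if y i > 0 then 1 else if y i < 0 then -1 else 0) * int (Suc i) else 0)"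

lemma dominant_label_uminus: "dominant_label m (\<lambda>i. - y i) = - dominant_label m y"
  by (simp add: dominant_label_def Let_def)

lemma dominant_label_bound: "\<bar>dominant_label m y\<bar> \<le> int m"
  by (auto simp: dominant_label_def Let_def abs_mult)

text \<open>Complementary labels mean that one coordinate dominates the first vector and has opposite signs in the
two. In a limit where both vectors agree, all coordinates vanish.\<close>

lemma opposite_dominant_labels:
  assumes "dominant_label m z = - dominant_label m y"
  obtains i where "i \<le> m" "\<And>l. l < m \<Longrightarrow> i < m \<and> \<bar>y l\<bar> \<le> \<bar>y i\<bar> \<and> y i * z i \<le> 0"
proof (cases "m = 0")
  case True
  then show ?thesis using that[of 0] by simp
next
  case False
  define I where "I y = (LEAST i. \<forall>l<m. \<bar>y l\<bar> \<le> \<bar>y i\<bar>)" for y :: "nat \<Rightarrow> real"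
  have I: "(\<forall>l<m. \<bar>y l\<bar> \<le> \<bar>y (I y)\<bar>) \<and> I y < m" for y
  proof -
    obtain i where i: "\<forall>l<m. \<bar>y l\<bar> \<le> \<bar>y i\<bar>" "i < m"
      using dominant_index[of m y] False by (metis not_gr_zero)
    show ?thesis
      using LeastI[of "\<lambda>i. \<forall>l<m. \<bar>y l\<bar> \<le> \<bar>y i\<bar>", OF i(1)]
        Least_le[of "\<lambda>i. \<forall>l<m. \<bar>y l\<bar> \<le> \<bar>y i\<bar>", OF i(1)] i(2)
      unfolding I_def by (metis (no_types) le_less_trans)
  qed
  have lab: "dominant_label m y = (if y (I y) > 0 then int (Suc (I y)) else
      if y (I y) < 0 then - int (Suc (I y)) else 0)" for y
    using I[of y] by (simp add: dominant_label_def Let_def flip: I_def)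
  have "y (I y) * z (I y) \<le> 0"
    using assms unfolding lab
    by (auto split: if_splits simp: mult_le_0_iff)
  then show ?thesis using that[of "I y"] I[of y] by auto
qed

text \<open>Borsuk's theorem for the symmetric neighbourhood \<open>{d > 0}\<close> of the origin in the span of the \<open>c j\<close>: an
odd map into one dimension less vanishes somewhere on the boundary. On the grid of mesh
\<open>1 / (N + 1)\<close>, label each point by the dominant coordinate of \<open>F\<close>. Then
\<open>combinatorial_borsuk\<close> gives a simplex crossing the boundary with complementary labels, and the simplices converge
to a zero along a subsequence.\<close>

lemma borsuk_zero:
  fixes F :: "'a::real_normed_vector \<Rightarrow> nat \<Rightarrow> real" and d :: "'a \<Rightarrow> real" and c :: "nat \<Rightarrow> 'a"
  assumes contF: "\<And>i. i < m \<Longrightarrow> continuous_on UNIV (\<lambda>u. F u i)"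
    and contd: "continuous_on UNIV d"
    and oddF: "\<And>u i. F (- u) i = - F u i"
    and evend: "\<And>u. d (- u) = d u"
    and d0: "d 0 > 0"
    and bdd: "\<And>a i. d (\<Sum>j\<le>m. a j *\<^sub>R c j) > 0 \<Longrightarrow> i \<le> m \<Longrightarrow> \<bar>a i\<bar> \<le> R"
  obtains u where "u \<in> span (c ` {..m})" "d u = 0" "\<And>i. i < m \<Longrightarrow> F u i = 0"
proof -
  define pt where "pt N v = (\<Sum>j\<le>m. (of_int (v j) / real (Suc N)) *\<^sub>R c j)" for N and v :: "nat \<Rightarrow> int"
  have pt_antipode: "pt N (antipode v) = - pt N v" for N v
    by (simp add: pt_def antipode_def sum_negf)
  have pt_dist: "norm (pt N v - pt N w) \<le> (\<Sum>j\<le>m. norm (c j)) / real (Suc N)"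
    if "\<And>i. \<bar>v i - w i\<bar> \<le> 1" for N v w
  proof -
    have "norm (pt N v - pt N w) = norm (\<Sum>j\<le>m. (of_int (v j - w j) / real (Suc N)) *\<^sub>R c j)"
      by (simp add: pt_def diff_divide_distrib scaleR_left_diff_distrib sum_subtractf)
    also have "\<dots> \<le> (\<Sum>j\<le>m. norm (c j) / real (Suc N))"
    proof (rule sum_norm_le)
      fix j
      have "\<bar>real_of_int (v j - w j)\<bar> \<le> 1" using that[of j] by linarith
      then show "norm ((of_int (v j - w j) / real (Suc N)) *\<^sub>R c j) \<le> norm (c j) / real (Suc N)"
        by (simp add: divide_right_mono mult_left_le_one_le)
    qed
    finally show ?thesis by (simp add: sum_divide_distrib)
  qed
  define K where "K = {\<Sum>i<Suc m. a i *\<^sub>R c i | a. \<forall>i<Suc m. \<bar>a i\<bar> \<le> R}"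
  define witness where "witness N x y v w i \<longleftrightarrow> x \<in> K \<and> i \<le> m \<and> d x > 0 \<and> d y \<le> 0 \<and>
      (\<forall>l<m. i < m \<and> \<bar>F v l\<bar> \<le> \<bar>F v i\<bar> \<and> F v i * F w i \<le> 0) \<and>
      (\<forall>z\<in>{y, v, w}. norm (z - x) \<le> (\<Sum>j\<le>m. norm (c j)) / real (Suc N))" for N x y v w i
  have "\<forall>N. \<exists>x y v w i. witness N x y v w i"
  proof
    fix N
    define T where "T = Suc (nat \<lceil>R * real (Suc N)\<rceil>)"
    let ?U = "{v. d (pt N v) > 0}" and ?lab = "\<lambda>v. dominant_label m (F (pt N v))"
    have box: "\<bar>of_int (v i) / real (Suc N)\<bar> \<le> R" if "d (pt N v) > 0" "i \<le> m" for v i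
      using bdd[of "\<lambda>j. of_int (v j) / real (Suc N)" i] that by (simp add: pt_def)
    obtain s where s: "\<And>v w i. v \<in> set s \<Longrightarrow> w \<in> set s \<Longrightarrow> \<bar>v i - w i\<bar> \<le> 1"
      "\<not> set s \<subseteq> ?U" "set s \<inter> ?U \<noteq> {}" "\<exists>v\<in>set s. \<exists>w\<in>set s. ?lab w = - ?lab v"
    proof (rule combinatorial_borsuk[of ?lab m ?U T])
      show "?lab (antipode v) = - ?lab v" for v
      proof -
        have "F (- pt N v) = (\<lambda>i. - F (pt N v) i)" using oddF by blast
        then show ?thesis by (simp add: pt_antipode dominant_label_uminus)
      qed
      show "\<bar>?lab v\<bar> \<le> int m" for v by (rule dominant_label_bound)
      show "antipode v \<in> ?U" if "v \<in> ?U" for v using that by (simp add: pt_antipode evend)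
      show "(\<lambda>_. 0) \<in> ?U" using d0 by (simp add: pt_def)
      show "\<bar>v i\<bar> < int T" if "v \<in> ?U" "i \<le> m" for v i
      proof -
        have "\<bar>real_of_int (v i)\<bar> \<le> R * real (Suc N)"
          using box[of v i] that by (simp add: field_simps)
        then show ?thesis unfolding T_def by linarith
      qed
    qed (use that in blast)
    then obtain x y v w where *: "x \<in> set s" "d (pt N x) > 0" "y \<in> set s" "d (pt N y) \<le> 0"
      "v \<in> set s" "w \<in> set s" "?lab w = - ?lab v" by force
    obtain i where i: "i \<le> m" "\<And>l. l < m \<Longrightarrow> i < m \<and> \<bar>F (pt N v) l\<bar> \<le> \<bar>F (pt N v) i\<bar> \<and> F (pt N v) i * F (pt N w) i \<le> 0"
      using opposite_dominant_labels[OF *(7)] by blast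
    have "pt N x \<in> K"
      unfolding K_def using box[OF *(2)]
      by (auto simp: pt_def lessThan_Suc_atMost intro!: exI[of _ "\<lambda>j. of_int (x j) / real (Suc N)"])
    moreover have "\<forall>z\<in>{pt N y, pt N v, pt N w}. norm (z - pt N x) \<le> (\<Sum>j\<le>m. norm (c j)) / real (Suc N)"
      using pt_dist s(1) * by blast
    ultimately have "witness N (pt N x) (pt N y) (pt N v) (pt N w) i"
      unfolding witness_def using i *(2,4) by simp
    then show "\<exists>x y v w i. witness N x y v w i" by blast
  qed
  then obtain x y v w i where "\<And>N. witness N (x N) (y N) (v N) (w N) (i N)"
    unfolding choice_iff by blast
  then have
    P: "\<And>N. x N \<in> K" "\<And>N. i N \<le> m" "\<And>N. d (x N) > 0" "\<And>N. d (y N) \<le> 0"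
      "\<And>N l. l < m \<Longrightarrow> i N < m \<and> \<bar>F (v N) l\<bar> \<le> \<bar>F (v N) (i N)\<bar> \<and> F (v N) (i N) * F (w N) (i N) \<le> 0"
    and near: "\<And>N z. z \<in> {y N, v N, w N} \<Longrightarrow> norm (z - x N) \<le> (\<Sum>j\<le>m. norm (c j)) / real (Suc N)"
    unfolding witness_def by blast+
  have "compact (K \<times> {..m})"
    unfolding K_def by (intro compact_Times compact_coordinate_box finite_imp_compact) simp
  then have "seq_compact (K \<times> {..m})" by (rule compact_imp_seq_compact)
  moreover have "\<forall>N. (x N, i N) \<in> K \<times> {..m}" using P(1,2) by simp
  ultimately obtain l \<sigma> where l: "l \<in> K \<times> {..m}" and \<sigma>: "strict_mono \<sigma>"
    and lim: "((\<lambda>N. (x N, i N)) \<circ> \<sigma>) \<longlonglongrightarrow> l"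
    by (rule seq_compactE)
  obtain u k where uk: "l = (u, k)" by (cases l)
  have x_lim: "(\<lambda>N. x (\<sigma> N)) \<longlonglongrightarrow> u"
    using tendsto_fst[OF lim] by (simp add: uk o_def)
  have "(\<lambda>N. i (\<sigma> N)) \<longlonglongrightarrow> k"
    using tendsto_snd[OF lim] by (simp add: uk o_def)
  then have i_ev: "\<forall>\<^sub>F N in sequentially. i (\<sigma> N) = k"
    by (simp add: tendsto_discrete)
  have null: "(\<lambda>N. (\<Sum>j\<le>m. norm (c j)) / real (Suc (\<sigma> N))) \<longlonglongrightarrow> 0"
    using LIMSEQ_subseq_LIMSEQ[OF LIMSEQ_Suc[OF lim_const_over_n] \<sigma>]
    by (simp add: o_def)
  have z_lim: "(\<lambda>N. z (\<sigma> N)) \<longlonglongrightarrow> u" if "\<And>N. z N \<in> {y N, v N, w N}" for z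
  proof -
    have "(\<lambda>N. z (\<sigma> N) - x (\<sigma> N)) \<longlonglongrightarrow> 0"
      by (rule Lim_null_comparison[OF always_eventually null]) (intro allI near that)
    from tendsto_add[OF this x_lim] show ?thesis by simp
  qed
  have cd: "(\<lambda>N. d (z N)) \<longlonglongrightarrow> d u" if "z \<longlonglongrightarrow> u" for z
    by (rule isCont_tendsto_compose[OF _ that])
       (use contd in \<open>simp add: continuous_on_eq_continuous_at\<close>)
  have cF: "(\<lambda>N. F (z N) j) \<longlonglongrightarrow> F u j" if "z \<longlonglongrightarrow> u" "j < m" for z j
    by (rule isCont_tendsto_compose[OF _ that(1)])
       (use contF[OF that(2)] in \<open>simp add: continuous_on_eq_continuous_at\<close>)
  have "d u \<ge> 0"
    using P(3) by (intro LIMSEQ_le_const[OF cd[OF x_lim]]) (auto intro!: exI[of _ 0] less_imp_le)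
  moreover have "d u \<le> 0"
    using P(4) z_lim[of y] by (intro LIMSEQ_le_const2[OF cd]) (auto intro!: exI[of _ 0])
  ultimately have "d u = 0" by simp
  moreover have "F u j = 0" if j: "j < m" for j
  proof -
    have vu: "(\<lambda>N. v (\<sigma> N)) \<longlonglongrightarrow> u" and wu: "(\<lambda>N. w (\<sigma> N)) \<longlonglongrightarrow> u"
      using z_lim[of v] z_lim[of w] by auto
    have ev: "\<forall>\<^sub>F N in sequentially. k < m \<and> \<bar>F (v (\<sigma> N)) j\<bar> \<le> \<bar>F (v (\<sigma> N)) k\<bar> \<and>
        F (v (\<sigma> N)) k * F (w (\<sigma> N)) k \<le> 0"
      using i_ev by eventually_elim (use P(5)[OF j] in auto)
    then have k: "k < m" by (metis (mono_tags, lifting) eventually_happens' sequentially_bot)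
    have "F u k * F u k \<le> 0"
      by (rule tendsto_upperbound[OF tendsto_mult[OF cF[OF vu k] cF[OF wu k]]])
         (use ev in \<open>auto elim: eventually_mono\<close>)
    then have "F u k = 0" by (auto simp: mult_le_0_iff)
    moreover have "\<bar>F u j\<bar> \<le> \<bar>F u k\<bar>"
      by (rule tendsto_le[OF _ tendsto_rabs[OF cF[OF vu k]] tendsto_rabs[OF cF[OF vu j]]])
         (use ev in \<open>auto elim: eventually_mono\<close>)
    ultimately show ?thesis by simp
  qed
  moreover have "u \<in> span (c ` {..m})"
  proof -
    obtain a where "u = (\<Sum>i<Suc m. a i *\<^sub>R c i)" using l by (auto simp: uk K_def)
    moreover have "(\<Sum>i<Suc m. a i *\<^sub>R c i) \<in> span (c ` {..m})"
      by (intro span_sum span_mul span_base) auto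
    ultimately show ?thesis by simp
  qed
  ultimately show ?thesis using that by blast
qed

section \<open>Orthonormal sequences and weak convergence\<close>

lemma weakly_converges_inner:
  fixes x :: "nat \<Rightarrow> 'a::real_inner"
  assumes "weakly_converges x l"
  shows "(\<lambda>n. x n \<bullet> v) \<longlonglongrightarrow> l \<bullet> v"
proof -
  have "(\<lambda>n. blinfun_apply (Blinfun (\<lambda>u. u \<bullet> v)) (x n)) \<longlonglongrightarrow> blinfun_apply (Blinfun (\<lambda>u. u \<bullet> v)) l"
    using assms by (simp add: weakly_converges_def)
  then show ?thesis by (simp add: bounded_linear_Blinfun_apply bounded_linear_inner_left)
qed

lemma weakly_converges_if_tendsto:
  "x \<longlonglongrightarrow> l \<Longrightarrow> weakly_converges x l"
  unfolding weakly_converges_def by (auto intro: tendsto_intros)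

lemma weakly_converges_add:
  "weakly_converges x l \<Longrightarrow> weakly_converges y k \<Longrightarrow> weakly_converges (\<lambda>n. x n + y n) (l + k)"
  unfolding weakly_converges_def by (auto simp: blinfun.add_right intro: tendsto_intros)

lemma weakly_converges_diff:
  "weakly_converges x l \<Longrightarrow> weakly_converges y k \<Longrightarrow> weakly_converges (\<lambda>n. x n - y n) (l - k)"
  unfolding weakly_converges_def by (auto simp: blinfun.diff_right intro: tendsto_intros)

lemma weakly_converges_subseq:
  "weakly_converges x l \<Longrightarrow> strict_mono s \<Longrightarrow> weakly_converges (\<lambda>n. x (s n)) l"
  unfolding weakly_converges_def using LIMSEQ_subseq_LIMSEQ by (fastforce simp: o_def)

lemma le_if_power2_le_mult:
  fixes x c :: real
  assumes "x\<^sup>2 \<le> c * x" "0 \<le> c"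
  shows "x \<le> c"
proof (rule ccontr)
  assume "\<not> x \<le> c"
  then have "c * x < x * x" using assms(2) by (intro mult_strict_right_mono) auto
  then show False using assms(1) by (simp add: power2_eq_square)
qed

locale orthonormal_seq =
  fixes b :: "nat \<Rightarrow> 'a::{real_inner, complete_space}"
  assumes inner_basis: "b i \<bullet> b j = (if i = j then 1 else 0)"
begin

definition partial :: "nat \<Rightarrow> 'a \<Rightarrow> 'a" where
  "partial N x = (\<Sum>i<N. (x \<bullet> b i) *\<^sub>R b i)"

lemma norm_basis [simp]: "norm (b i) = 1"
  using inner_basis[of i i] by (simp add: norm_eq_sqrt_inner)

lemma inner_combination:
  "finite A \<Longrightarrow> (\<Sum>i\<in>A. a i *\<^sub>R b i) \<bullet> b j = (if j \<in> A then a j else 0)"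
  by (simp add: inner_sum_left inner_basis if_distrib cong: if_cong)

lemma norm_combination:
  assumes "finite A"
  shows "(norm (\<Sum>i\<in>A. a i *\<^sub>R b i))\<^sup>2 = (\<Sum>i\<in>A. (a i)\<^sup>2)"
proof -
  have "(norm (\<Sum>i\<in>A. a i *\<^sub>R b i))\<^sup>2 = (\<Sum>i\<in>A. a i * ((\<Sum>j\<in>A. a j *\<^sub>R b j) \<bullet> b i))"
    by (simp add: power2_norm_eq_inner inner_sum_right)
  also have "\<dots> = (\<Sum>i\<in>A. (a i)\<^sup>2)"
    by (intro sum.cong refl) (simp only: inner_combination[OF assms], simp add: power2_eq_square)
  finally show ?thesis .
qed

lemma norm_partial_le: "norm (partial N x) \<le> norm x"
proof -
  have "(norm (partial N x))\<^sup>2 = partial N x \<bullet> x"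
  proof -
    have "(norm (partial N x))\<^sup>2 = (\<Sum>i<N. (x \<bullet> b i)\<^sup>2)"
      unfolding partial_def by (rule norm_combination) simp
    moreover have "partial N x \<bullet> x = (\<Sum>i<N. (x \<bullet> b i)\<^sup>2)"
      by (simp add: partial_def inner_sum_left inner_commute[of "b _" x] power2_eq_square)
    ultimately show ?thesis by simp
  qed
  also have "\<dots> \<le> norm x * norm (partial N x)"
    using norm_cauchy_schwarz[of "partial N x" x] by (simp add: mult.commute)
  finally show ?thesis by (rule le_if_power2_le_mult) simp
qed

lemma bessel: "(\<Sum>i<N. (x \<bullet> b i)\<^sup>2) \<le> (norm x)\<^sup>2"
proof -
  have "(\<Sum>i<N. (x \<bullet> b i)\<^sup>2) = (norm (partial N x))\<^sup>2"
    unfolding partial_def by (rule norm_combination[symmetric]) simp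
  then show ?thesis by (simp add: norm_partial_le power_mono)
qed

text \<open>The partial sums are Cauchy, because the squared distance of two of them is a tail of a convergent
series.\<close>

lemma riesz_fischer:
  assumes "\<And>N. (\<Sum>i<N. (a i)\<^sup>2) \<le> R\<^sup>2" "R \<ge> 0"
  obtains x where "(\<lambda>N. \<Sum>i<N. a i *\<^sub>R b i) \<longlonglongrightarrow> x" "norm x \<le> R" "\<And>i. x \<bullet> b i = a i"
proof -
  let ?s = "\<lambda>N. \<Sum>i<N. a i *\<^sub>R b i"
  have "summable (\<lambda>i. (a i)\<^sup>2)"
    by (rule bounded_imp_summable[of _ "R\<^sup>2"]) (use assms(1)[of "Suc _"] in \<open>auto simp: lessThan_Suc_atMost\<close>)
  then have C: "Cauchy (\<lambda>N. \<Sum>i<N. (a i)\<^sup>2)"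
    by (simp add: summable_iff_convergent convergent_Cauchy)
  have "Cauchy ?s"
  proof (rule CauchyI')
    fix e :: real assume e: "0 < e"
    then obtain M where M: "\<And>m n. m \<ge> M \<Longrightarrow> n \<ge> M \<Longrightarrow> dist (\<Sum>i<m. (a i)\<^sup>2) (\<Sum>i<n. (a i)\<^sup>2) < e\<^sup>2"
      using C unfolding Cauchy_def by (meson zero_less_power)
    have "norm (?s m - ?s n) < e" if "m \<ge> M" "n > m" for m n
    proof -
      have split: "(\<Sum>i<n. f i) = (\<Sum>i<m. f i) + (\<Sum>i=m..<n. f i)" for f :: "nat \<Rightarrow> 'x::ab_group_add"
        using that(2) by (simp add: lessThan_atLeast0 sum.atLeastLessThan_concat)
      have "(norm (?s m - ?s n))\<^sup>2 = (\<Sum>i=m..<n. (a i)\<^sup>2)"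
        unfolding split[of "\<lambda>i. a i *\<^sub>R b i"] by (simp add: norm_combination)
      also have "\<dots> < e\<^sup>2"
        using M[of n m] that split[of "\<lambda>i. (a i)\<^sup>2"] by (simp add: dist_real_def)
      finally show ?thesis using e by (auto intro: power_less_imp_less_base)
    qed
    then show "\<exists>M. \<forall>m\<ge>M. \<forall>n>m. dist (?s m) (?s n) < e" unfolding dist_norm by blast
  qed
  then obtain x where x: "?s \<longlonglongrightarrow> x"
    using Cauchy_convergent_iff convergent_def by blast
  have "norm (?s N) \<le> R" for N
    by (rule power2_le_imp_le) (use assms in \<open>simp_all add: norm_combination\<close>)
  then have "norm x \<le> R"
    using LIMSEQ_le_const2[OF tendsto_norm[OF x]] by blast
  moreover have "x \<bullet> b j = a j" for j
  proof -
    have "(\<lambda>N. ?s N \<bullet> b j) \<longlonglongrightarrow> a j"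
      by (rule tendsto_eventually, rule eventually_sequentiallyI[of "Suc j"])
         (simp add: inner_combination)
    then show ?thesis
      using tendsto_inner[OF x tendsto_const] LIMSEQ_unique by blast
  qed
  ultimately show ?thesis using that x by blast
qed

lemma orthogonal_closure_span:
  assumes "\<And>i. x \<bullet> b i = 0" "y \<in> closure (span (range b))"
  shows "x \<bullet> y = 0"
proof -
  have "span (range b) \<subseteq> {y. x \<bullet> y = 0}"
    by (rule span_minimal) (auto simp: assms subspace_def inner_add_right)
  then have "closure (span (range b)) \<subseteq> {y. x \<bullet> y = 0}"
    by (rule closure_minimal) (rule closed_hyperplane)
  then show ?thesis using assms(2) by blast
qed

lemma partial_converges:
  obtains p where "(\<lambda>N. partial N x) \<longlonglongrightarrow> p" "p \<in> closure (span (range b))" "norm p \<le> norm x"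
    "\<And>i. p \<bullet> b i = x \<bullet> b i"
proof -
  obtain p where p: "(\<lambda>N. partial N x) \<longlonglongrightarrow> p" "norm p \<le> norm x" "\<And>i. p \<bullet> b i = x \<bullet> b i"
    using riesz_fischer[of "\<lambda>i. x \<bullet> b i" "norm x"] bessel[of x] unfolding partial_def by auto
  have "partial N x \<in> span (range b)" for N
    unfolding partial_def by (intro span_sum span_mul span_base) auto
  then have "p \<in> closure (span (range b))"
    using p(1) unfolding closure_sequential by (intro exI[of _ "\<lambda>N. partial N x"]) simp
  then show ?thesis using that p by blast
qed

lemma partial_tendsto:
  assumes "x \<in> closure (span (range b))"
  shows "(\<lambda>N. partial N x) \<longlonglongrightarrow> x"
proof -
  obtain p where p: "(\<lambda>N. partial N x) \<longlonglongrightarrow> p" "p \<in> closure (span (range b))"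
    "\<And>i. p \<bullet> b i = x \<bullet> b i" using partial_converges by blast
  have "(x - p) \<bullet> x = 0" "(x - p) \<bullet> p = 0"
    by (rule orthogonal_closure_span; simp add: assms p inner_diff_left)+
  then have "(x - p) \<bullet> (x - p) = 0" by (simp add: inner_diff_right)
  then show ?thesis using p(1) by simp
qed

end

locale hilbert_basis = orthonormal_seq +
  assumes total: "closure (span (range b)) = UNIV"
begin

lemma partial_tendsto_all: "(\<lambda>N. partial N x) \<longlonglongrightarrow> x"
  by (rule partial_tendsto) (simp add: total)

lemma riesz_representation:
  fixes L :: "'a \<Rightarrow>\<^sub>L real"
  obtains y where "\<And>x. blinfun_apply L x = y \<bullet> x"
proof -
  have "(\<Sum>i<N. (L (b i))\<^sup>2) \<le> (norm L)\<^sup>2" for N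
  proof -
    let ?v = "\<Sum>i<N. L (b i) *\<^sub>R b i"
    have "(norm ?v)\<^sup>2 = (\<Sum>i<N. (L (b i))\<^sup>2)" by (rule norm_combination) simp
    then have "(norm ?v)\<^sup>2 = L ?v"
      by (simp add: blinfun.sum_right blinfun.scaleR_right power2_eq_square)
    also have "\<dots> \<le> norm L * norm ?v"
      using norm_blinfun[of L ?v] by simp
    finally have "norm ?v \<le> norm L" by (rule le_if_power2_le_mult) simp
    then have "(norm ?v)\<^sup>2 \<le> (norm L)\<^sup>2" by (rule power_mono) simp
    then show ?thesis by (simp add: norm_combination)
  qed
  then obtain y where y: "\<And>i. y \<bullet> b i = L (b i)"
    using riesz_fischer[of "\<lambda>i. L (b i)" "norm L", OF _ norm_ge_zero] by blast
  have "L x = y \<bullet> x" for x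
  proof (rule LIMSEQ_unique)
    show "(\<lambda>N. L (partial N x)) \<longlonglongrightarrow> L x"
      by (intro blinfun.tendsto tendsto_const partial_tendsto_all)
    have "L (partial N x) = y \<bullet> partial N x" for N
      by (simp add: partial_def blinfun.sum_right blinfun.scaleR_right inner_sum_right y)
    moreover have "(\<lambda>N. y \<bullet> partial N x) \<longlonglongrightarrow> y \<bullet> x"
      by (intro tendsto_inner tendsto_const partial_tendsto_all)
    ultimately show "(\<lambda>N. L (partial N x)) \<longlonglongrightarrow> y \<bullet> x" by simp
  qed
  then show ?thesis using that by blast
qed

text \<open>For bounded sequences, coordinatewise convergence is enough: a functional is the inner product with
some \<open>y\<close>, and \<open>y\<close> is approximated in norm by its partial sums.\<close>

lemma weakly_converges_if_coordinates:
  fixes x :: "nat \<Rightarrow> 'a" and R :: real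
  assumes bdd: "\<And>n. norm (x n) \<le> R"
    and coord: "\<And>i. (\<lambda>n. x n \<bullet> b i) \<longlonglongrightarrow> l \<bullet> b i"
  shows "weakly_converges x l"
  unfolding weakly_converges_def
proof
  fix L :: "'a \<Rightarrow>\<^sub>L real"
  obtain y where y: "\<And>x. L x = y \<bullet> x" using riesz_representation by blast
  have R: "R \<ge> 0" using order_trans[OF norm_ge_zero bdd[of 0]] .
  show "(\<lambda>n. L (x n)) \<longlonglongrightarrow> L l"
  proof (rule LIMSEQ_I)
    fix e :: real assume e: "0 < e"
    define K where "K = R + norm l + 1"
    have K: "K > 0" using R by (simp add: K_def add_nonneg_pos)
    obtain N where N: "norm (partial N y - y) < e / (2 * K)"
      using LIMSEQ_D[OF partial_tendsto_all[of y], of "e / (2 * K)"] e K by auto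
    have "(\<lambda>n. partial N y \<bullet> x n) \<longlonglongrightarrow> partial N y \<bullet> l"
      unfolding partial_def inner_sum_left inner_scaleR_left
      by (intro tendsto_sum tendsto_mult tendsto_const)
         (use coord in \<open>simp add: inner_commute[of "b _"]\<close>)
    then obtain n0 where n0: "\<And>n. n \<ge> n0 \<Longrightarrow> norm (partial N y \<bullet> x n - partial N y \<bullet> l) < e / 2"
      using LIMSEQ_D[of _ _ "e / 2"] e by (metis half_gt_zero)
    have "norm (L (x n) - L l) < e" if "n \<ge> n0" for n
    proof -
      have "L (x n) - L l = (y - partial N y) \<bullet> (x n - l) + (partial N y \<bullet> x n - partial N y \<bullet> l)"
        by (simp add: y algebra_simps)
      moreover have "\<bar>(y - partial N y) \<bullet> (x n - l)\<bar> \<le> e / (2 * K) * K"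
      proof (rule order_trans[OF Cauchy_Schwarz_ineq2 mult_mono])
        show "norm (y - partial N y) \<le> e / (2 * K)" using N by (simp add: norm_minus_commute)
        show "norm (x n - l) \<le> K"
          using norm_triangle_ineq4[of "x n" l] bdd[of n] by (simp add: K_def)
      qed (use e K in auto)
      moreover have "e / (2 * K) * K = e / 2" using K by simp
      ultimately show ?thesis using n0[OF that] unfolding real_norm_def by linarith
    qed
    then show "\<exists>n0. \<forall>n\<ge>n0. norm (L (x n) - L l) < e" by blast
  qed
qed

text \<open>The coordinate sequences lie in a product of compact intervals, which is compact and metrizable.\<close>

lemma weakly_convergent_subsequence:
  fixes x :: "nat \<Rightarrow> 'a" and R :: real
  assumes bdd: "\<And>n. norm (x n) \<le> R"
  obtains l s where "strict_mono s" "weakly_converges (\<lambda>n. x (s n)) l" "norm l \<le> R"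
proof -
  have R: "R \<ge> 0" using order_trans[OF norm_ge_zero bdd[of 0]] .
  have "compactin (product_topology (\<lambda>_::nat. euclidean :: real topology) UNIV) (PiE UNIV (\<lambda>_. {-R..R}))"
    by (simp add: compactin_PiE)
  then have "compact (PiE UNIV (\<lambda>_::nat. {-R..R}))"
    by (simp add: euclidean_product_topology)
  moreover have "\<forall>n. (\<lambda>i. x n \<bullet> b i) \<in> PiE UNIV (\<lambda>_. {-R..R})"
  proof (intro allI PiE_I)
    fix n i
    have "\<bar>x n \<bullet> b i\<bar> \<le> R"
      using Cauchy_Schwarz_ineq2[of "x n" "b i"] bdd[of n] by simp
    then show "x n \<bullet> b i \<in> {-R..R}" by (simp add: abs_le_iff)
  qed simp
  ultimately obtain a s where s: "strict_mono s" and lim: "((\<lambda>n i. x n \<bullet> b i) \<circ> s) \<longlonglongrightarrow> a"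
    unfolding compact_def by metis
  have coord: "(\<lambda>n. x (s n) \<bullet> b i) \<longlonglongrightarrow> a i" for i
    using tendsto_compose[OF _ lim, of "\<lambda>f. f i"] continuous_on_product_coordinates[of i]
    by (auto simp: continuous_on_def o_def)
  have "(\<Sum>i<N. (a i)\<^sup>2) \<le> R\<^sup>2" for N
  proof (rule LIMSEQ_le_const2)
    show "(\<lambda>n. \<Sum>i<N. (x (s n) \<bullet> b i)\<^sup>2) \<longlonglongrightarrow> (\<Sum>i<N. (a i)\<^sup>2)"
      by (intro tendsto_sum tendsto_power coord)
    show "\<exists>n0. \<forall>n\<ge>n0. (\<Sum>i<N. (x (s n) \<bullet> b i)\<^sup>2) \<le> R\<^sup>2"
      using order_trans[OF bessel power_mono[OF bdd norm_ge_zero]] by blast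
  qed
  then obtain l where l: "norm l \<le> R" "\<And>i. l \<bullet> b i = a i"
    using riesz_fischer[of a R, OF _ R] by blast
  have "weakly_converges (\<lambda>n. x (s n)) l"
    by (rule weakly_converges_if_coordinates[of _ R]) (use bdd coord l in auto)
  then show ?thesis using that s l by blast
qed

lemma norm_functional_le:
  fixes L :: "'a \<Rightarrow>\<^sub>L real"
  assumes "\<And>N. norm (\<Sum>i<N. L (b i) *\<^sub>R b i) \<le> E"
  shows "norm L \<le> E"
proof (rule norm_blinfun_bound)
  show E: "0 \<le> E" using assms[of 0] by simp
  fix v
  show "norm (L v) \<le> E * norm v"
  proof (rule LIMSEQ_le_const2)
    show "(\<lambda>N. norm (L (partial N v))) \<longlonglongrightarrow> norm (L v)"
      by (intro tendsto_norm blinfun.tendsto tendsto_const partial_tendsto_all)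
    have "norm (L (partial N v)) \<le> E * norm v" for N
    proof -
      have "L (partial N v) = (\<Sum>i<N. L (b i) *\<^sub>R b i) \<bullet> v"
        by (simp add: partial_def blinfun.sum_right blinfun.scaleR_right inner_sum_left inner_commute[of "b _" v] mult.commute)
      then show ?thesis
        using order_trans[OF Cauchy_Schwarz_ineq2 mult_right_mono[OF assms norm_ge_zero]] by simp
    qed
    then show "\<exists>n0. \<forall>N\<ge>n0. norm (L (partial N v)) \<le> E * norm v" by blast
  qed
qed

end

section \<open>The splitting of the space and the \<open>\<tau>\<close>-norm\<close>

lemma orth_proj_eqI:
  assumes "subspace S" "p \<in> S" "u - p \<in> orthogonal_comp S"
  shows "orth_proj S u = p"
  unfolding orth_proj_def
proof (rule the_equality)
  fix q assume q: "q \<in> S \<and> u - q \<in> orthogonal_comp S"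
  have "q - p \<in> S" using assms q by (simp add: subspace_diff)
  then have "(q - p) \<bullet> (u - p) = 0" "(q - p) \<bullet> (u - q) = 0"
    using assms(3) q by (auto simp: orthogonal_comp_def orthogonal_def)
  then have "(q - p) \<bullet> (q - p) = 0" by (simp add: inner_diff_right)
  then show "q = p" by simp
qed (use assms in simp)

locale splitting =
  fixes Y :: "'a::{real_inner, complete_space} set" and e f :: "nat \<Rightarrow> 'a"
  assumes subspace_Y: "subspace Y"
    and basis_Y: "orthonormal_basis_of Y e"
    and basis_Z: "orthonormal_basis_of (orthogonal_comp Y) f"
begin

sublocale E: orthonormal_seq e
  using basis_Y by unfold_locales (simp add: orthonormal_basis_of_def)

sublocale F: orthonormal_seq f
  using basis_Z by unfold_locales (simp add: orthonormal_basis_of_def)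

lemma closure_span_e: "closure (span (range e)) = Y"
  using basis_Y by (simp add: orthonormal_basis_of_def)

lemma closure_span_f: "closure (span (range f)) = orthogonal_comp Y"
  using basis_Z by (simp add: orthonormal_basis_of_def)

lemma e_in_Y: "e i \<in> Y"
  using closure_span_e closure_subset[of "span (range e)"] span_base[of "e i" "range e"] by blast

lemma f_in_Z: "f i \<in> orthogonal_comp Y"
  using closure_span_f closure_subset[of "span (range f)"] span_base[of "f i" "range f"] by blast

lemma inner_YZ: "y \<in> Y \<Longrightarrow> z \<in> orthogonal_comp Y \<Longrightarrow> y \<bullet> z = 0"
  by (simp add: orthogonal_comp_def orthogonal_def)

lemma inner_ef [simp]: "e i \<bullet> f j = 0" "f j \<bullet> e i = 0"
  using inner_YZ[OF e_in_Y f_in_Z] by (simp_all add: inner_commute)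

abbreviation "P \<equiv> orth_proj Y"
abbreviation "Q \<equiv> orth_proj (orthogonal_comp Y)"

lemma projections:
  shows P_in: "P u \<in> Y" and Q_in: "Q u \<in> orthogonal_comp Y" and PQ: "P u + Q u = u"
    and E_partial: "(\<lambda>N. E.partial N u) \<longlonglongrightarrow> P u"
proof -
  obtain p where p: "(\<lambda>N. E.partial N u) \<longlonglongrightarrow> p" "p \<in> closure (span (range e))"
    "\<And>i. p \<bullet> e i = u \<bullet> e i"
    using E.partial_converges by blast
  have pY: "p \<in> Y" using p(2) closure_span_e by simp
  have "(u - p) \<bullet> y = 0" if "y \<in> Y" for y
    by (rule E.orthogonal_closure_span) (simp_all add: inner_diff_left p(3) closure_span_e that)
  then have q: "u - p \<in> orthogonal_comp Y"
    by (simp add: orthogonal_comp_def orthogonal_def inner_commute)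
  have P: "P u = p" by (rule orth_proj_eqI[OF subspace_Y pY q])
  have "Q u = u - p"
    by (rule orth_proj_eqI[OF subspace_orthogonal_comp q])
       (use pY orthogonal_comp_subset[of Y] in auto)
  then show "P u \<in> Y" "Q u \<in> orthogonal_comp Y" "P u + Q u = u" "(\<lambda>N. E.partial N u) \<longlonglongrightarrow> P u"
    using P pY q p(1) by simp_all
qed

lemma P_inner_e [simp]: "P u \<bullet> e i = u \<bullet> e i"
  using PQ[of u] inner_YZ[OF e_in_Y Q_in] by (metis add.right_neutral inner_add_left inner_commute)

lemma Q_inner_f [simp]: "Q u \<bullet> f i = u \<bullet> f i"
  using PQ[of u] inner_YZ[OF P_in f_in_Z] by (metis add.left_neutral inner_add_left)

lemma F_partial: "(\<lambda>N. F.partial N u) \<longlonglongrightarrow> Q u"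
proof -
  have "(\<lambda>N. F.partial N (Q u)) \<longlonglongrightarrow> Q u"
    by (rule F.partial_tendsto) (simp add: closure_span_f Q_in)
  then show ?thesis by (simp add: F.partial_def)
qed

lemma Q_add: "Q (u + v) = Q u + Q v"
proof (rule LIMSEQ_unique[OF F_partial])
  have "F.partial N (u + v) = F.partial N u + F.partial N v" for N
    by (simp add: F.partial_def inner_add_left scaleR_left_distrib sum.distrib)
  then show "(\<lambda>N. F.partial N (u + v)) \<longlonglongrightarrow> Q u + Q v"
    by (simp add: tendsto_add F_partial)
qed

lemma norm_Q_le: "norm (Q u) \<le> norm u"
  using LIMSEQ_le_const2[OF tendsto_norm[OF F_partial]] F.norm_partial_le by blast

definition basis :: "nat \<Rightarrow> 'a" where
  "basis n = (if even n then e (n div 2) else f (n div 2))"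

lemma hilbert_basis: "hilbert_basis basis"
proof
  show "basis i \<bullet> basis j = (if i = j then 1 else 0)" for i j
    by (auto simp: basis_def E.inner_basis F.inner_basis elim!: evenE oddE)
  have "u \<in> closure (span (range basis))" for u
    unfolding closure_sequential
  proof (intro exI[of _ "\<lambda>N. E.partial N u + F.partial N u"] conjI allI)
    fix N
    have "e i \<in> range basis" "f i \<in> range basis" for i
      using rangeI[of basis "2 * i"] rangeI[of basis "2 * i + 1"] by (simp_all add: basis_def)
    then show "E.partial N u + F.partial N u \<in> span (range basis)"
      unfolding E.partial_def F.partial_def
      by (intro span_add span_sum span_mul span_base) auto
    show "(\<lambda>N. E.partial N u + F.partial N u) \<longlonglongrightarrow> u"
      using tendsto_add[OF E_partial[of u] F_partial[of u]] by (simp add: PQ)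
  qed
  then show "closure (span (range basis)) = UNIV" by blast
qed

sublocale B: hilbert_basis basis by (rule hilbert_basis)

lemma Q_finite:
  assumes "\<And>j. j > k \<Longrightarrow> u \<bullet> f j = 0"
  shows "Q u = (\<Sum>j\<le>k. (u \<bullet> f j) *\<^sub>R f j)"
proof (rule LIMSEQ_unique[OF F_partial])
  have "F.partial N u = (\<Sum>j\<le>k. (u \<bullet> f j) *\<^sub>R f j)" if "N \<ge> Suc k" for N
    unfolding F.partial_def
    by (rule sum.mono_neutral_right) (use that assms in auto)
  then show "(\<lambda>N. F.partial N u) \<longlonglongrightarrow> (\<Sum>j\<le>k. (u \<bullet> f j) *\<^sub>R f j)"
    by (intro tendsto_eventually eventually_sequentiallyI)
qed

lemma Yk_iff: "u \<in> Yk Y f k \<longleftrightarrow> (\<forall>j>k. u \<bullet> f j = 0)"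
proof
  assume "u \<in> Yk Y f k"
  then obtain y z where u: "u = y + z" "y \<in> Y" "z \<in> span (f ` {..k})" by (auto simp: Yk_def)
  have "z \<bullet> f j = 0" if "j > k" for j
  proof -
    have "span (f ` {..k}) \<subseteq> {z. z \<bullet> f j = 0}"
      by (rule span_minimal) (use that in \<open>auto simp: F.inner_basis subspace_def inner_add_left\<close>)
    then show ?thesis using u by blast
  qed
  then show "\<forall>j>k. u \<bullet> f j = 0"
    using u inner_YZ[OF _ f_in_Z] by (simp add: inner_add_left)
next
  assume "\<forall>j>k. u \<bullet> f j = 0"
  then have "Q u \<in> span (f ` {..k})"
    by (subst Q_finite[of k]) (simp, intro span_sum span_mul span_base, simp)
  then show "u \<in> Yk Y f k"
    unfolding Yk_def using P_in[of u] PQ[of u] by (intro CollectI exI[of _ "P u"] exI[of _ "Q u"]) simp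
qed

lemma Zk_I:
  assumes "\<And>j. u \<bullet> e j = 0" "\<And>j. j < k \<Longrightarrow> u \<bullet> f j = 0"
  shows "u \<in> Zk f k"
proof -
  have "E.partial N u = 0" for N by (simp add: E.partial_def assms)
  then have "P u = 0" using LIMSEQ_unique[OF E_partial[of u]] by simp
  then have "(\<lambda>N. F.partial N u) \<longlonglongrightarrow> u" using F_partial[of u] PQ[of u] by simp
  moreover have "F.partial N u \<in> span (f ` {k..})" for N
    unfolding F.partial_def
  proof (rule span_sum)
    fix i show "(u \<bullet> f i) *\<^sub>R f i \<in> span (f ` {k..})"
      by (cases "i < k") (simp_all add: assms span_zero span_mul span_base)
  qed
  ultimately show ?thesis
    unfolding Zk_def closure_sequential by (intro exI[of _ "\<lambda>N. F.partial N u"]) simp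
qed

abbreviation "tau \<equiv> tau_norm Y e"

lemma tau_eq: "tau u = max (\<Sum>j. 1 / 2 ^ (j + 1) * \<bar>u \<bullet> e j\<bar>) (norm (Q u))"
  by (simp add: tau_norm_def)

lemma half_sums: "(\<lambda>j. 1 / 2 ^ (j + 1) * r) sums (r::real)"
  using sums_mult2[OF power_half_series, of r] by (simp add: power_one_over)

lemma tau_term_le: "1 / 2 ^ (j + 1) * \<bar>u \<bullet> e j\<bar> \<le> 1 / 2 ^ (j + 1) * norm u"
  using Cauchy_Schwarz_ineq2[of u "e j"] by (intro mult_left_mono) auto

lemma tau_summable: "summable (\<lambda>j. 1 / 2 ^ (j + 1) * \<bar>u \<bullet> e j\<bar>)"
proof (rule summable_comparison_test')
  show "summable (\<lambda>j. 1 / 2 ^ (j + 1) * norm u)" using half_sums by (rule sums_summable)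
  show "norm (1 / 2 ^ (j + 1) * \<bar>u \<bullet> e j\<bar>) \<le> 1 / 2 ^ (j + 1) * norm u" if "j \<ge> 0" for j
    using tau_term_le[of j u] by simp
qed

lemma tau_le_norm: "tau u \<le> norm u"
proof -
  have "(\<Sum>j. 1 / 2 ^ (j + 1) * \<bar>u \<bullet> e j\<bar>) \<le> (\<Sum>j. 1 / 2 ^ (j + 1) * norm u)"
    by (rule suminf_le[OF tau_term_le tau_summable]) (use half_sums in \<open>rule sums_summable\<close>)
  then show ?thesis unfolding tau_eq using sums_unique[OF half_sums[of "norm u"]] norm_Q_le by simp
qed

lemma tau_nonneg: "tau u \<ge> 0"
  unfolding tau_eq using norm_ge_zero[of "Q u"] by (simp add: le_max_iff_disj)

lemma tau_triangle: "tau (u + v) \<le> tau u + tau v"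
proof -
  let ?t = "\<lambda>u j. 1 / 2 ^ (j + 1) * \<bar>u \<bullet> e j\<bar>"
  have "suminf (?t (u + v)) \<le> (\<Sum>j. ?t u j + ?t v j)"
  proof (rule suminf_le[OF _ tau_summable summable_add[OF tau_summable tau_summable]])
    fix j
    have "\<bar>(u + v) \<bullet> e j\<bar> \<le> \<bar>u \<bullet> e j\<bar> + \<bar>v \<bullet> e j\<bar>" by (simp add: inner_add_left)
    then show "?t (u + v) j \<le> ?t u j + ?t v j"
      unfolding distrib_left[symmetric] by (intro mult_left_mono) auto
  qed
  also have "\<dots> = suminf (?t u) + suminf (?t v)"
    by (rule suminf_add[symmetric]; rule tau_summable)
  finally have "suminf (?t (u + v)) \<le> suminf (?t u) + suminf (?t v)" .
  moreover have "norm (Q (u + v)) \<le> norm (Q u) + norm (Q v)"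
    unfolding Q_add by (rule norm_triangle_ineq)
  ultimately show ?thesis unfolding tau_eq by linarith
qed

text \<open>On a bounded part of \<open>Y\<^sub>k\<close>, weak convergence implies \<open>\<tau>\<close>-convergence: the weighted series is dominated by a
geometric one, and the component in \<open>Z\<close> has only finitely many coordinates.\<close>

lemma tau_tendsto_zero:
  assumes weak: "weakly_converges w 0" and bdd: "\<And>n. norm (w n) \<le> R"
    and fin: "\<And>n j. j > k \<Longrightarrow> w n \<bullet> f j = 0"
  shows "(\<lambda>n. tau (w n)) \<longlonglongrightarrow> 0"
proof -
  let ?t = "\<lambda>j n. 1 / 2 ^ (j + 1) * \<bar>w n \<bullet> e j\<bar>"
  have lim: "(\<lambda>n. \<bar>w n \<bullet> v\<bar>) \<longlonglongrightarrow> 0" for v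
    using tendsto_rabs[OF weakly_converges_inner[OF weak, of v]] by simp
  have "(\<lambda>n. \<Sum>j. ?t j n) \<longlonglongrightarrow> (\<Sum>j::nat. 0)"
  proof (intro conjunct2[OF conjunct2[OF tannerys_theorem]])
    show "(\<lambda>n. ?t j n) \<longlonglongrightarrow> 0" for j
      using tendsto_mult_right_zero[OF lim] .
    show "summable (\<lambda>j. 1 / 2 ^ (j + 1) * R)" using half_sums by (rule sums_summable)
    have "norm (?t j n) \<le> 1 / 2 ^ (j + 1) * R" for j n
    proof -
      have "1 / 2 ^ (j + 1) * norm (w n) \<le> 1 / 2 ^ (j + 1) * R"
        using bdd by (intro mult_left_mono) auto
      then show ?thesis using tau_term_le[of j "w n"] by simp
    qed
    then show "\<forall>\<^sub>F (j, n) in at_top \<times>\<^sub>F at_top. norm (?t j n) \<le> 1 / 2 ^ (j + 1) * R"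
      by (simp add: case_prod_unfold)
  qed simp
  then have S: "(\<lambda>n. \<Sum>j. ?t j n) \<longlonglongrightarrow> 0" by simp
  have "(\<lambda>n. Q (w n)) \<longlonglongrightarrow> (\<Sum>j\<le>k. 0 *\<^sub>R f j)"
  proof -
    have "Q (w n) = (\<Sum>j\<le>k. (w n \<bullet> f j) *\<^sub>R f j)" for n by (rule Q_finite) (rule fin)
    moreover have "(\<lambda>n. w n \<bullet> f j) \<longlonglongrightarrow> 0" for j
      using weakly_converges_inner[OF weak, of "f j"] by simp
    then have "(\<lambda>n. \<Sum>j\<le>k. (w n \<bullet> f j) *\<^sub>R f j) \<longlonglongrightarrow> (\<Sum>j\<le>k. 0 *\<^sub>R f j)"
      by (intro tendsto_sum tendsto_scaleR tendsto_const)
    ultimately show ?thesis by simp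
  qed
  then have "(\<lambda>n. norm (Q (w n))) \<longlonglongrightarrow> 0" by (simp add: tendsto_norm_zero)
  from tendsto_max[OF S this] show ?thesis unfolding tau_eq by simp
qed

end

section \<open>Upper semicontinuity from the bound on \<open>\<tau>\<close>-balls\<close>

lemma C1_derivative:
  assumes "C1_functional \<phi>"
  shows "(\<phi> has_derivative blinfun_apply (dual_deriv \<phi> u)) (at u)"
proof -
  have d: "(\<phi> has_derivative frechet_derivative \<phi> (at u)) (at u)"
    using assms by (simp add: C1_functional_def frechet_derivative_works)
  then show ?thesis
    by (simp add: dual_deriv_def bounded_linear_Blinfun_apply has_derivative_bounded_linear)
qed

lemma C1_continuous: "C1_functional \<phi> \<Longrightarrow> continuous_on UNIV \<phi>"
  by (meson C1_derivative has_derivative_continuous continuous_at_imp_continuous_on)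

lemma C1_continuous_deriv:
  assumes "C1_functional \<phi>" "x \<longlonglongrightarrow> l"
  shows "(\<lambda>n. dual_deriv \<phi> (x n)) \<longlonglongrightarrow> dual_deriv \<phi> l"
  using assms unfolding C1_functional_def
  by (metis continuous_on_tendsto_compose UNIV_I eventually_sequentially)

lemma C1_ray_derivative:
  assumes "C1_functional \<phi>"
  shows "((\<lambda>s. \<phi> (u + s *\<^sub>R w)) has_real_derivative dual_deriv \<phi> (u + s *\<^sub>R w) w) (at s)"
proof -
  have "((\<lambda>s. \<phi> (u + s *\<^sub>R w)) has_derivative (\<lambda>h. dual_deriv \<phi> (u + s *\<^sub>R w) (h *\<^sub>R w))) (at s)"
    by (rule has_derivative_compose[OF _ C1_derivative[OF assms]]) (auto intro!: derivative_eq_intros)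
  then show ?thesis
    by (simp add: has_field_derivative_def blinfun.scaleR_right mult.commute[of _ "dual_deriv _ _ _"])
qed

lemma C1_mean_value:
  assumes "C1_functional \<phi>"
  obtains s where "0 < s" "s < 1" "\<phi> (u + w) - \<phi> u = dual_deriv \<phi> (u + s *\<^sub>R w) w"
  using MVT2[of 0 1 "\<lambda>s. \<phi> (u + s *\<^sub>R w)" "\<lambda>s. dual_deriv \<phi> (u + s *\<^sub>R w) w"]
    C1_ray_derivative[OF assms, of u w] that by auto

text \<open>The gain from adding a weakly null sequence does not depend, in the limit, on the base point. The
difference of the two gains is, by the mean value theorem in the direction \<open>w\<close>, a difference of
gradients at points with the same weak limit.\<close>

lemma increment_asymptotically_local:
  assumes C1: "C1_functional \<phi>" and weak: "gradient_weakly_seq_continuous \<phi>"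
    and g: "weakly_converges g 0" and \<eta>: "\<eta> > 0"
  shows "\<forall>\<^sub>F n in sequentially. \<bar>(\<phi> (u + w + g n) - \<phi> (u + w)) - (\<phi> (u + g n) - \<phi> u)\<bar> < \<eta>"
proof (rule ccontr)
  assume "\<not> ?thesis"
  from not_eventually_sequentiallyD[OF this] obtain r :: "nat \<Rightarrow> nat" where r: "strict_mono r"
    "\<And>n. \<not> \<bar>(\<phi> (u + w + g (r n)) - \<phi> (u + w)) - (\<phi> (u + g (r n)) - \<phi> u)\<bar> < \<eta>"
    by blast
  have "\<exists>s\<in>{0..1}. (\<phi> (u + w + g n) - \<phi> (u + w)) - (\<phi> (u + g n) - \<phi> u) =
      dual_deriv \<phi> (u + s *\<^sub>R w + g n) w - dual_deriv \<phi> (u + s *\<^sub>R w) w" for n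
  proof -
    let ?D = "\<lambda>s. \<phi> (u + g n + s *\<^sub>R w) - \<phi> (u + s *\<^sub>R w)"
    have "\<exists>z::real>0. z < 1 \<and> ?D 1 - ?D 0 =
      (1 - 0) * (dual_deriv \<phi> (u + g n + z *\<^sub>R w) w - dual_deriv \<phi> (u + z *\<^sub>R w) w)"
      by (rule MVT2) (auto intro!: DERIV_diff C1_ray_derivative[OF C1])
    then show ?thesis by (force simp: algebra_simps)
  qed
  then obtain s where s: "\<And>n. s n \<in> {0..1}" and eq:
    "\<And>n. (\<phi> (u + w + g n) - \<phi> (u + w)) - (\<phi> (u + g n) - \<phi> u) =
      dual_deriv \<phi> (u + s n *\<^sub>R w + g n) w - dual_deriv \<phi> (u + s n *\<^sub>R w) w"
    by metis
  obtain t q where q: "strict_mono q" "((\<lambda>n. s (r n)) \<circ> q) \<longlonglongrightarrow> t"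
    using s compact_Icc[of "0::real" 1] unfolding compact_def by metis
  define p where "p n = r (q n)" for n
  have p: "strict_mono p" using strict_mono_o[OF r(1) q(1)] by (simp add: p_def[abs_def] o_def)
  have lim: "(\<lambda>n. u + s (p n) *\<^sub>R w) \<longlonglongrightarrow> u + t *\<^sub>R w"
    using q(2) by (auto simp: p_def o_def intro!: tendsto_intros)
  have "weakly_converges (\<lambda>n. u + s (p n) *\<^sub>R w + g (p n)) (u + t *\<^sub>R w + 0)"
    by (intro weakly_converges_add weakly_converges_if_tendsto[OF lim] weakly_converges_subseq[OF g p])
  then have "(\<lambda>n. dual_deriv \<phi> (u + s (p n) *\<^sub>R w + g (p n)) w - dual_deriv \<phi> (u + s (p n) *\<^sub>R w) w)
      \<longlonglongrightarrow> dual_deriv \<phi> (u + t *\<^sub>R w + 0) w - dual_deriv \<phi> (u + t *\<^sub>R w) w"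
    using weak weakly_converges_if_tendsto[OF lim] unfolding gradient_weakly_seq_continuous_def
    by (intro tendsto_diff) blast+
  then have "\<forall>\<^sub>F n in sequentially. \<bar>dual_deriv \<phi> (u + s (p n) *\<^sub>R w + g (p n)) w - dual_deriv \<phi> (u + s (p n) *\<^sub>R w) w\<bar> < \<eta>"
    using \<eta> by (auto dest!: tendstoD simp: dist_real_def)
  then obtain n where "\<bar>dual_deriv \<phi> (u + s (p n) *\<^sub>R w + g (p n)) w - dual_deriv \<phi> (u + s (p n) *\<^sub>R w) w\<bar> < \<eta>"
    using eventually_happens' sequentially_bot by blast
  then show False using r(2)[of "q n"] eq[of "p n"] by (simp add: p_def)
qed

context splitting
begin

text \<open>If \<open>\<phi> (x n) \<ge> \<phi> l + \<eta>\<close> infinitely often, then adding such increments \<open>x n - l\<close> one after the other,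
each chosen late enough to have small \<open>\<tau>\<close>-norm and to gain at least \<open>\<eta> / 2\<close> over the previous sum, leads to arbitrarily
large values of \<open>\<phi>\<close> inside one \<open>\<tau>\<close>-ball.\<close>

lemma tau_weak_upper_semicontinuity:
  assumes C1: "C1_functional \<phi>" and weak: "gradient_weakly_seq_continuous \<phi>"
    and bound: "\<And>\<delta>. \<delta> > 0 \<Longrightarrow> \<exists>C. \<forall>u. tau u < \<delta> \<longrightarrow> \<phi> u \<le> C"
    and x: "weakly_converges x l" "(\<lambda>n. tau (x n - l)) \<longlonglongrightarrow> 0" and \<eta>: "\<eta> > 0"
  shows "\<forall>\<^sub>F n in sequentially. \<phi> (x n) < \<phi> l + \<eta>"
proof (rule ccontr)
  assume "\<not> ?thesis"
  from not_eventually_sequentiallyD[OF this] obtain r :: "nat \<Rightarrow> nat" where r: "strict_mono r" "\<And>n. \<not> \<phi> (x (r n)) < \<phi> l + \<eta>"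
    by blast
  define g where "g n = x (r n) - l" for n
  have g: "weakly_converges g 0"
    using weakly_converges_diff[OF weakly_converges_subseq[OF x(1) r(1)] weakly_converges_if_tendsto[OF tendsto_const[of l]]]
    by (simp add: g_def[abs_def])
  have tau_g: "(\<lambda>n. tau (g n)) \<longlonglongrightarrow> 0"
    using LIMSEQ_subseq_LIMSEQ[OF x(2) r(1)] by (simp add: g_def o_def)
  have jump: "\<phi> (l + g n) - \<phi> l \<ge> \<eta>" for n
    using r(2)[of n] by (simp add: g_def)
  \<comment> \<open>The bounds \<open>1 - (1/2) ^ N\<close> leave room for one more increment at every stage.\<close>
  have climb: "\<exists>v. tau v \<le> 1 - (1/2) ^ N \<and> \<phi> (l + v) \<ge> \<phi> l + real N * (\<eta> / 2)" for N
  proof (induction N)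
    case 0
    have "tau 0 \<le> 0" using tau_le_norm[of 0] by simp
    then show ?case by (intro exI[of _ 0]) simp
  next
    case (Suc N)
    then obtain v where v: "tau v \<le> 1 - (1/2) ^ N" "\<phi> (l + v) \<ge> \<phi> l + real N * (\<eta> / 2)" by blast
    have "\<forall>\<^sub>F n in sequentially. tau (g n) < (1/2) ^ Suc N"
      by (rule order_tendstoD(2)[OF tau_g]) simp
    then have "\<forall>\<^sub>F n in sequentially. tau (g n) < (1/2) ^ Suc N \<and>
        \<bar>(\<phi> (l + v + g n) - \<phi> (l + v)) - (\<phi> (l + g n) - \<phi> l)\<bar> < \<eta> / 2"
      by (rule eventually_conj) (rule increment_asymptotically_local[OF C1 weak g], use \<eta> in simp)
    then obtain n where n: "tau (g n) < (1/2) ^ Suc N"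
        "\<bar>(\<phi> (l + v + g n) - \<phi> (l + v)) - (\<phi> (l + g n) - \<phi> l)\<bar> < \<eta> / 2"
      using eventually_happens' sequentially_bot by blast
    have "tau (v + g n) \<le> 1 - (1/2) ^ Suc N"
      using tau_triangle[of v "g n"] v(1) n(1) by simp
    moreover have "\<phi> (l + (v + g n)) \<ge> \<phi> l + real (Suc N) * (\<eta> / 2)"
    proof -
      have N: "real (Suc N) * (\<eta> / 2) = real N * (\<eta> / 2) + \<eta> / 2" by (simp add: field_simps)
      show ?thesis
        using n(2) jump[of n] v(2) unfolding N abs_less_iff add.assoc[symmetric] by linarith
    qed
    ultimately show ?case by blast
  qed
  obtain C where C: "\<And>u. tau u < tau l + 2 \<Longrightarrow> \<phi> u \<le> C"
    using bound[of "tau l + 2"] tau_nonneg[of l] by fastforce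
  obtain N :: nat where N: "real N * (\<eta> / 2) > C - \<phi> l"
    using reals_Archimedean3[of "\<eta> / 2"] \<eta> by (metis half_gt_zero)
  obtain v where v: "tau v \<le> 1 - (1/2) ^ N" "\<phi> (l + v) \<ge> \<phi> l + real N * (\<eta> / 2)"
    using climb by blast
  have "(1/2 :: real) ^ N > 0" by simp
  then have "tau (l + v) < tau l + 2"
    using tau_triangle[of l v] v(1) by linarith
  then show False using C[of "l + v"] v(2) N by simp
qed

end

section \<open>Linking\<close>

context splitting
begin

text \<open>In the span of \<open>e 0, \<dots>, e (N - 1), f 0, \<dots>, f k\<close>, a solution makes all coordinates of \<open>u - h u\<close> vanish
except the one along \<open>f k\<close>, and lies on the boundary of the set where \<open>\<parallel>u\<parallel> < \<rho>\<close> and \<open>\<parallel>u - h u\<parallel> < r\<close>.\<close>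

definition galerkin_solution :: "('a \<Rightarrow> 'a) \<Rightarrow> nat \<Rightarrow> real \<Rightarrow> real \<Rightarrow> nat \<Rightarrow> 'a \<Rightarrow> bool" where
  "galerkin_solution h k r \<rho> N u \<longleftrightarrow>
     (\<forall>j\<ge>N. u \<bullet> e j = 0) \<and> (\<forall>j>k. u \<bullet> f j = 0) \<and>
     (\<forall>j<N. (u - h u) \<bullet> e j = 0) \<and> (\<forall>j<k. (u - h u) \<bullet> f j = 0) \<and>
     min (\<rho> - norm u) (r - norm (u - h u)) = 0"

lemma galerkin_solution_exists:
  fixes h :: "'a \<Rightarrow> 'a"
  assumes cont: "continuous_on UNIV h" and odd: "\<And>u. h (- u) = - h u"
    and "0 < r" "0 < \<rho>"
  shows "\<exists>u. galerkin_solution h k r \<rho> N u"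
proof -
  \<comment> \<open>The last of these \<open>N + k + 1\<close> vectors is \<open>f k\<close>, the direction shared by \<open>Y\<^sub>k\<close> and \<open>Z\<^sub>k\<close>.\<close>
  define c where "c j = (if j < N then e j else f (j - N))" for j
  have inner_c: "c i \<bullet> c j = (if i = j then 1 else 0)" for i j
    by (auto simp: c_def E.inner_basis F.inner_basis)
  interpret C: orthonormal_seq c by unfold_locales (rule inner_c)
  define d where "d u = min (\<rho> - norm u) (r - norm (u - h u))" for u
  have "h 0 + h 0 = 0" using odd[of 0] by (simp add: eq_neg_iff_add_eq_0)
  then have "2 *\<^sub>R h 0 = 0" by (simp add: scaleR_2)
  then have h0: "h 0 = 0" by simp
  obtain u where u: "u \<in> span (c ` {..N + k})" "d u = 0" "\<And>i. i < N + k \<Longrightarrow> (u - h u) \<bullet> c i = 0"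
  proof (rule borsuk_zero[of "N + k" "\<lambda>u i. (u - h u) \<bullet> c i" d c \<rho>])
    show "continuous_on UNIV (\<lambda>u. (u - h u) \<bullet> c i)" for i
      by (intro continuous_intros cont)
    show "continuous_on UNIV d"
      unfolding d_def by (intro continuous_intros cont)
    show "(- u - h (- u)) \<bullet> c i = - ((u - h u) \<bullet> c i)" for u i
      by (simp add: odd algebra_simps)
    show "d (- u) = d u" for u
    proof -
      have "norm (h u - u) = norm (u - h u)" by (rule norm_minus_commute)
      then show ?thesis by (simp add: d_def odd)
    qed
    show "0 < d 0" using assms by (simp add: d_def h0)
    show "\<bar>a i\<bar> \<le> \<rho>" if "0 < d (\<Sum>j\<le>N + k. a j *\<^sub>R c j)" "i \<le> N + k" for a i
    proof -
      let ?v = "\<Sum>j\<le>N + k. a j *\<^sub>R c j"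
      have "a i = ?v \<bullet> c i" using that(2) by (simp add: C.inner_combination)
      then have "\<bar>a i\<bar> \<le> norm ?v" using Cauchy_Schwarz_ineq2[of ?v "c i"] by simp
      then show ?thesis using that(1) by (simp add: d_def)
    qed
  qed blast
  have span_orth: "u \<bullet> v = 0" if "\<And>i. i \<le> N + k \<Longrightarrow> c i \<bullet> v = 0" for v
  proof -
    have "span (c ` {..N + k}) \<subseteq> {u. u \<bullet> v = 0}"
      by (rule span_minimal) (use that in \<open>auto simp: subspace_def inner_add_left\<close>)
    then show ?thesis using u(1) by blast
  qed
  have "galerkin_solution h k r \<rho> N u"
    unfolding galerkin_solution_def
  proof (intro conjI allI impI)
    show "u \<bullet> e j = 0" if "j \<ge> N" for j
      by (rule span_orth) (use that in \<open>auto simp: c_def E.inner_basis\<close>)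
    show "u \<bullet> f j = 0" if "j > k" for j
      by (rule span_orth) (use that in \<open>auto simp: c_def F.inner_basis\<close>)
    show "(u - h u) \<bullet> e j = 0" if "j < N" for j
      using u(3)[of j] that by (simp add: c_def)
    show "(u - h u) \<bullet> f j = 0" if "j < k" for j
      using u(3)[of "N + j"] that by (simp add: c_def)
    show "min (\<rho> - norm u) (r - norm (u - h u)) = 0" using u(2) by (simp add: d_def)
  qed
  then show ?thesis ..
qed

text \<open>The image of the disk under \<open>u \<mapsto> u - h u\<close> meets the sphere of radius \<open>r\<close> in \<open>Z\<^sub>k\<close>. For the Galerkin
solutions \<open>u N\<close>, the component in \<open>Y\<close> equals a partial sum of \<open>h (u N)\<close>; since \<open>h\<close> is compact,
a weakly convergent subsequence of the \<open>u N\<close> converges in norm.\<close>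

lemma odd_compact_displacement_linking:
  fixes h :: "'a \<Rightarrow> 'a"
  assumes cont: "continuous_on UNIV h" and odd: "\<And>u. h (- u) = - h u"
    and compact: "\<And>x l. (\<And>n. x n \<in> Yk Y f k \<and> norm (x n) \<le> \<rho>) \<Longrightarrow> l \<in> Yk Y f k \<Longrightarrow> norm l \<le> \<rho> \<Longrightarrow>
        weakly_converges x l \<Longrightarrow> (\<lambda>n. h (x n)) \<longlonglongrightarrow> h l"
    and pos: "0 < r" "0 < \<rho>"
    and sphere: "\<And>u. u \<in> Yk Y f k \<Longrightarrow> norm u = \<rho> \<Longrightarrow> u - h u \<in> Zk f k \<Longrightarrow> r < norm (u - h u)"
  shows "\<exists>u\<in>Yk Y f k. norm u \<le> \<rho> \<and> u - h u \<in> Zk f k \<and> norm (u - h u) = r"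
proof -
  obtain u where "\<And>N. galerkin_solution h k r \<rho> N (u N)"
    using galerkin_solution_exists[OF cont odd pos] by metis
  then have u: "\<And>N j. j \<ge> N \<Longrightarrow> u N \<bullet> e j = 0" "\<And>N j. j > k \<Longrightarrow> u N \<bullet> f j = 0"
    "\<And>N j. j < N \<Longrightarrow> (u N - h (u N)) \<bullet> e j = 0" "\<And>N j. j < k \<Longrightarrow> (u N - h (u N)) \<bullet> f j = 0"
    "\<And>N. min (\<rho> - norm (u N)) (r - norm (u N - h (u N))) = 0"
    unfolding galerkin_solution_def by blast+
  have bdd: "norm (u N) \<le> \<rho>" for N using u(5)[of N] by linarith
  obtain w s where s: "strict_mono s" and weak: "weakly_converges (\<lambda>n. u (s n)) w" and w: "norm w \<le> \<rho>"
    by (rule B.weakly_convergent_subsequence[of u \<rho>, OF bdd])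
  have f_lim: "(\<lambda>n. u (s n) \<bullet> f j) \<longlonglongrightarrow> w \<bullet> f j" for j by (rule weakly_converges_inner[OF weak])
  have "w \<bullet> f j = 0" if "j > k" for j
    using f_lim[of j] u(2)[OF that] LIMSEQ_unique[OF _ tendsto_const] by fastforce
  then have wY: "w \<in> Yk Y f k" by (simp add: Yk_iff)
  have h_lim: "(\<lambda>n. h (u (s n))) \<longlonglongrightarrow> h w"
    by (rule compact[OF _ wY w weak]) (simp add: Yk_iff u(2) bdd)
  define v where "v = P (h w) + (\<Sum>j\<le>k. (w \<bullet> f j) *\<^sub>R f j)"
  \<comment> \<open>Up to finitely many coordinates, \<open>u N\<close> is controlled by the compact map \<open>h\<close>.\<close>
  have split: "u N = E.partial N (h (u N)) + (\<Sum>j\<le>k. (u N \<bullet> f j) *\<^sub>R f j)" for N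
  proof -
    have "E.partial M (u N) = E.partial N (u N)" if "M \<ge> N" for M
      unfolding E.partial_def by (rule sum.mono_neutral_right) (use that u(1) in auto)
    then have "(\<lambda>M. E.partial M (u N)) \<longlonglongrightarrow> E.partial N (u N)"
      by (intro tendsto_eventually eventually_sequentiallyI)
    then have "P (u N) = E.partial N (u N)" by (rule LIMSEQ_unique[OF E_partial])
    moreover have "E.partial N (u N) = E.partial N (h (u N))"
      unfolding E.partial_def using u(3)[of _ N] by (intro sum.cong) (auto simp: inner_diff_left)
    moreover have "Q (u N) = (\<Sum>j\<le>k. (u N \<bullet> f j) *\<^sub>R f j)"
      by (rule Q_finite) (rule u(2))
    ultimately show ?thesis using PQ[of "u N"] by simp
  qed
  have "(\<lambda>n. E.partial (s n) (h (u (s n)) - h w)) \<longlonglongrightarrow> 0"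
  proof (rule Lim_null_comparison[OF always_eventually])
    show "\<forall>n. norm (E.partial (s n) (h (u (s n)) - h w)) \<le> norm (h (u (s n)) - h w)"
      by (simp add: E.norm_partial_le)
    show "(\<lambda>n. norm (h (u (s n)) - h w)) \<longlonglongrightarrow> 0"
      using h_lim by (simp add: tendsto_norm_zero LIM_zero)
  qed
  moreover have "(\<lambda>n. E.partial (s n) (h w)) \<longlonglongrightarrow> P (h w)"
    using LIMSEQ_subseq_LIMSEQ[OF E_partial s] by (simp add: o_def)
  ultimately have "(\<lambda>n. E.partial (s n) (h (u (s n)) - h w) + E.partial (s n) (h w)) \<longlonglongrightarrow> 0 + P (h w)"
    by (rule tendsto_add)
  then have "(\<lambda>n. E.partial (s n) (h (u (s n)))) \<longlonglongrightarrow> P (h w)"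
    by (simp add: E.partial_def inner_diff_left scaleR_left_diff_distrib sum_subtractf)
  then have "(\<lambda>n. E.partial (s n) (h (u (s n))) + (\<Sum>j\<le>k. (u (s n) \<bullet> f j) *\<^sub>R f j)) \<longlonglongrightarrow> v"
    unfolding v_def by (intro tendsto_add tendsto_sum tendsto_scaleR tendsto_const f_lim)
  then have v_lim: "(\<lambda>n. u (s n)) \<longlonglongrightarrow> v" by (simp flip: split)
  have g_lim: "(\<lambda>n. u (s n) - h (u (s n))) \<longlonglongrightarrow> v - h v"
    using cont v_lim by (intro tendsto_diff isCont_tendsto_compose[where g = h])
      (simp_all add: continuous_on_eq_continuous_at)
  have "v \<bullet> f j = 0" if "j > k" for j
    using LIMSEQ_unique[OF tendsto_inner[OF v_lim tendsto_const[of "f j"]]] u(2)[OF that] by simp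
  then have vY: "v \<in> Yk Y f k" by (simp add: Yk_iff)
  have "(v - h v) \<bullet> e j = 0" for j
  proof (rule LIMSEQ_unique[OF tendsto_inner[OF g_lim tendsto_const]])
    have "(u (s n) - h (u (s n))) \<bullet> e j = 0" if "n \<ge> Suc j" for n
      using u(3)[of j "s n"] seq_suble[OF s, of n] that by simp
    then show "(\<lambda>n. (u (s n) - h (u (s n))) \<bullet> e j) \<longlonglongrightarrow> 0"
      by (intro tendsto_eventually eventually_sequentiallyI)
  qed
  moreover have "(v - h v) \<bullet> f j = 0" if "j < k" for j
    using LIMSEQ_unique[OF tendsto_inner[OF g_lim tendsto_const[of "f j"]]] u(4)[OF that] by simp
  ultimately have vZ: "v - h v \<in> Zk f k" by (rule Zk_I)
  have "(\<lambda>n. min (\<rho> - norm (u (s n))) (r - norm (u (s n) - h (u (s n))))) \<longlonglongrightarrow>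
      min (\<rho> - norm v) (r - norm (v - h v))"
    by (intro tendsto_min tendsto_diff tendsto_const tendsto_norm v_lim g_lim)
  then have "min (\<rho> - norm v) (r - norm (v - h v)) = 0"
    unfolding u(5) using LIMSEQ_unique[OF _ tendsto_const] by blast
  then have v: "norm v \<le> \<rho>" "norm (v - h v) \<le> r" "norm v = \<rho> \<or> norm (v - h v) = r" by linarith+
  then have "norm (v - h v) = r" using sphere[OF vY _ vZ] by linarith
  then show ?thesis using vY vZ v(1) by blast
qed

end

section \<open>Ekeland's variational principle\<close>

text \<open>The usual proof: repeatedly pass to an almost minimal point of the set of those \<open>g\<close> that lie below
the current point in the order \<open>\<psi> g + \<epsilon> * dist g x \<le> \<psi> x\<close>. Lower semicontinuity is stated as sequential closedness of
sublevel sets.\<close>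

lemma ekeland:
  fixes \<psi> :: "'a::metric_space \<Rightarrow> real"
  assumes complete: "complete S" and x0: "x0 \<in> S" and below: "\<And>x. x \<in> S \<Longrightarrow> c \<le> \<psi> x"
    and lsc: "\<And>x l a. (\<And>n. x n \<in> S) \<Longrightarrow> x \<longlonglongrightarrow> l \<Longrightarrow> l \<in> S \<Longrightarrow> (\<And>n. \<psi> (x n) \<le> a) \<Longrightarrow> \<psi> l \<le> a"
    and \<epsilon>: "0 < \<epsilon>"
  shows "\<exists>h\<in>S. \<forall>g\<in>S. \<psi> g + \<epsilon> * dist g h \<le> \<psi> h \<longrightarrow> g = h"
proof -
  define T where "T x = {g \<in> S. \<psi> g + \<epsilon> * dist g x \<le> \<psi> x}" for x
  have T_self: "x \<in> T x" if "x \<in> S" for x using that by (simp add: T_def)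
  have T_trans: "z \<in> T x" if "z \<in> T y" "y \<in> T x" for x y z
  proof -
    have "\<epsilon> * dist z x \<le> \<epsilon> * dist z y + \<epsilon> * dist y x"
      using \<epsilon> dist_triangle[of z x y] by (simp flip: distrib_left)
    then show ?thesis using that by (simp add: T_def)
  qed
  have near_inf: "\<exists>y. y \<in> S \<and> y \<in> T x \<and> (\<forall>g\<in>T x. \<psi> y \<le> \<psi> g + (1/2) ^ n)" if "x \<in> S" for x and n :: nat
  proof -
    have "bdd_below (\<psi> ` T x)" by (rule bdd_belowI2[of _ c]) (simp add: T_def below)
    moreover have ne: "\<psi> ` T x \<noteq> {}" using T_self[OF that] by blast
    moreover have "Inf (\<psi> ` T x) < Inf (\<psi> ` T x) + (1/2) ^ n" by simp
    ultimately obtain y where "y \<in> T x" "\<psi> y < Inf (\<psi> ` T x) + (1/2) ^ n"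
      using cInf_lessD[OF ne] by blast
    moreover have "Inf (\<psi> ` T x) \<le> \<psi> g" if "g \<in> T x" for g
      using \<open>bdd_below (\<psi> ` T x)\<close> that by (auto intro: cInf_lower)
    ultimately show ?thesis by (intro exI[of _ y]) (force simp: T_def)
  qed
  obtain x where xS: "\<And>n. x n \<in> S" and x: "\<And>n. x (Suc n) \<in> T (x n) \<and> (\<forall>g\<in>T (x n). \<psi> (x (Suc n)) \<le> \<psi> g + (1/2) ^ n)"
    using dependent_nat_choice[of "\<lambda>_ x. x \<in> S" "\<lambda>n x y. y \<in> T x \<and> (\<forall>g\<in>T x. \<psi> y \<le> \<psi> g + (1/2) ^ n)"]
      x0 near_inf by metis
  have x_T: "x m \<in> T (x n)" if "n \<le> m" for n m
    using that by (induction rule: dec_induct) (use T_self xS x T_trans in blast)+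
  have "decseq (\<lambda>n. \<psi> (x n))"
    unfolding decseq_Suc_iff
  proof
    fix n
    have "\<psi> (x (Suc n)) + \<epsilon> * dist (x (Suc n)) (x n) \<le> \<psi> (x n)" using x[of n] by (simp add: T_def)
    moreover have "0 \<le> \<epsilon> * dist (x (Suc n)) (x n)" using \<epsilon> by simp
    ultimately show "\<psi> (x (Suc n)) \<le> \<psi> (x n)" by linarith
  qed
  then have "convergent (\<lambda>n. \<psi> (x n))"
    using decseq_convergent[of "\<lambda>n. \<psi> (x n)" c] below[OF xS] by (metis convergentI)
  then have C: "Cauchy (\<lambda>n. \<psi> (x n))" by (rule convergent_Cauchy)
  have "Cauchy x"
  proof (rule metric_CauchyI)
    fix d :: real assume "0 < d"
    then obtain M where M: "\<And>m n. m \<ge> M \<Longrightarrow> n \<ge> M \<Longrightarrow> dist (\<psi> (x m)) (\<psi> (x n)) < \<epsilon> * d"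
      using metric_CauchyD[OF C, of "\<epsilon> * d"] \<epsilon> by auto
    have *: "dist (x m) (x n) < d" if "M \<le> n" "n \<le> m" for m n
    proof -
      have "\<epsilon> * dist (x m) (x n) \<le> \<psi> (x n) - \<psi> (x m)" using x_T[OF that(2)] by (simp add: T_def)
      also have "\<dots> < \<epsilon> * d" using M[of m n] that by (simp add: dist_real_def)
      finally show ?thesis using \<epsilon> by simp
    qed
    have "dist (x m) (x n) < d" if "M \<le> m" "M \<le> n" for m n
      using *[of n m] *[of m n] that by (cases "n \<le> m") (auto simp: dist_commute)
    then show "\<exists>M. \<forall>m\<ge>M. \<forall>n\<ge>M. dist (x m) (x n) < d" by blast
  qed
  then obtain h where hS: "h \<in> S" and h: "x \<longlonglongrightarrow> h"
    using complete xS unfolding complete_def by blast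
  have hT: "h \<in> T (x n)" for n
  proof -
    have "\<psi> h + \<epsilon> * dist h (x n) \<le> \<psi> (x n) + d" if d: "0 < d" for d
    proof -
      have "(\<lambda>m. dist (x m) (x n)) \<longlonglongrightarrow> dist h (x n)" by (intro tendsto_intros h)
      then have "\<forall>\<^sub>F m in sequentially. dist h (x n) - d / \<epsilon> < dist (x m) (x n)"
        by (rule order_tendstoD) (use d \<epsilon> in simp)
      then obtain M where M: "\<And>m. m \<ge> M \<Longrightarrow> dist h (x n) - d / \<epsilon> < dist (x m) (x n)"
        unfolding eventually_sequentially by blast
      have "\<psi> h \<le> \<psi> (x n) - \<epsilon> * dist h (x n) + d"
      proof (rule lsc[OF _ LIMSEQ_ignore_initial_segment[OF h, of "M + n"] hS])
        fix m
        have "\<epsilon> * (dist h (x n) - d / \<epsilon>) < \<epsilon> * dist (x (m + (M + n))) (x n)"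
          using M[of "m + (M + n)"] \<epsilon> by (intro mult_strict_left_mono) auto
        moreover have "\<epsilon> * (dist h (x n) - d / \<epsilon>) = \<epsilon> * dist h (x n) - d"
          using \<epsilon> by (simp add: right_diff_distrib)
        moreover have "\<psi> (x (m + (M + n))) + \<epsilon> * dist (x (m + (M + n))) (x n) \<le> \<psi> (x n)"
          using x_T[of n "m + (M + n)"] by (simp add: T_def)
        ultimately show "\<psi> (x (m + (M + n))) \<le> \<psi> (x n) - \<epsilon> * dist h (x n) + d" by linarith
      qed (rule xS)
      then show ?thesis by simp
    qed
    then show ?thesis using hS by (simp add: T_def field_le_epsilon)
  qed
  show ?thesis
  proof (intro bexI[OF _ hS] ballI impI)
    fix g assume "g \<in> S" "\<psi> g + \<epsilon> * dist g h \<le> \<psi> h"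
    then have g: "g \<in> T (x n)" for n using T_trans[OF _ hT] by (simp add: T_def)
    have "dist (x (Suc n)) g \<le> (1/2) ^ n / \<epsilon>" for n
    proof -
      have "\<psi> g + \<epsilon> * dist g (x (Suc n)) \<le> \<psi> (x (Suc n))" using g[of "Suc n"] by (simp add: T_def)
      moreover have "\<psi> (x (Suc n)) \<le> \<psi> g + (1/2) ^ n" using x[of n] g[of n] by blast
      ultimately have "\<epsilon> * dist g (x (Suc n)) \<le> (1/2) ^ n" by linarith
      then show ?thesis using \<epsilon> by (simp add: dist_commute pos_le_divide_eq mult.commute)
    qed
    then have "\<forall>n. norm (dist (x (Suc n)) g) \<le> (1/2) ^ n / \<epsilon>" by simp
    moreover have "(\<lambda>n. (1/2 :: real) ^ n / \<epsilon>) \<longlonglongrightarrow> 0"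
      using tendsto_divide[OF LIMSEQ_power_zero tendsto_const, of "1/2::real" \<epsilon>] \<epsilon> by simp
    ultimately have "(\<lambda>n. dist (x (Suc n)) g) \<longlonglongrightarrow> 0"
      by (rule Lim_null_comparison[OF always_eventually])
    then have "(\<lambda>n. x (Suc n)) \<longlonglongrightarrow> g" by (rule tendsto_dist_iff[THEN iffD2])
    then show "g = h" using LIMSEQ_unique[OF LIMSEQ_Suc[OF h]] by simp
  qed
qed

section \<open>Deformations of a disk\<close>

text \<open>A continuous version of normalisation: zero for \<open>norm x \<le> q\<close>, the unit vector in the direction of \<open>x\<close>
for \<open>norm x \<ge> 2 * q\<close>, and a shorter vector in that direction in between.\<close>

definition cutoff :: "real \<Rightarrow> 'a::real_normed_vector \<Rightarrow> 'a" where
  "cutoff q x = (min 1 (max 0 (norm x - q) / q) / max (norm x) q) *\<^sub>R x"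

lemma cutoff_minus: "cutoff q (- x) = - cutoff q x"
  by (simp add: cutoff_def)

lemma continuous_cutoff: "q > 0 \<Longrightarrow> continuous_on UNIV (cutoff q)"
  unfolding cutoff_def by (intro continuous_intros) auto

lemma cutoff_eq_0: "norm x \<le> q \<Longrightarrow> cutoff q x = 0"
  by (simp add: cutoff_def)

lemma norm_cutoff_le:
  assumes "q > 0"
  shows "norm (cutoff q x) \<le> 1"
proof -
  have "norm (cutoff q x) = min 1 (max 0 (norm x - q) / q) * (norm x / max (norm x) q)"
    using assms by (simp add: cutoff_def)
  also have "\<dots> \<le> 1 * 1"
    using assms by (intro mult_mono) (auto simp: divide_le_eq_1)
  finally show ?thesis by simp
qed

lemma norm_cutoff_eq_1:
  assumes "q > 0" "norm x \<ge> 2 * q"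
  shows "norm (cutoff q x) = 1"
proof -
  have "max 0 (norm x - q) / q \<ge> 1" "max (norm x) q = norm x" "norm x > 0"
    using assms by (auto simp: le_divide_eq)
  then show ?thesis by (simp add: cutoff_def)
qed

lemma cutoff_positive_multiple:
  assumes "q > 0" "norm x > q"
  obtains a where "a > 0" "cutoff q x = a *\<^sub>R x"
proof
  show "min 1 (max 0 (norm x - q) / q) / max (norm x) q > 0"
    using assms by (intro divide_pos_pos) (auto simp: less_max_iff_disj)
qed (simp add: cutoff_def)

locale fountain_level = splitting +
  fixes \<phi> :: "'a \<Rightarrow> real" and k :: nat and \<rho> :: real
  assumes C1: "C1_functional \<phi>"
    and even: "\<And>u. \<phi> (- u) = \<phi> u"
    and weak: "gradient_weakly_seq_continuous \<phi>"
    and tau_bound: "\<And>\<delta>. \<delta> > 0 \<Longrightarrow> \<exists>C. \<forall>u. tau_norm Y e u < \<delta> \<longrightarrow> \<phi> u \<le> C"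
    and radius: "\<rho> > 0"
begin

definition disk :: "'a set" where "disk = {u \<in> Yk Y f k. norm u \<le> \<rho>}"

lemma disk_iff: "u \<in> disk \<longleftrightarrow> (\<forall>j>k. u \<bullet> f j = 0) \<and> norm u \<le> \<rho>"
  by (simp add: disk_def Yk_iff)

lemma zero_in_disk: "0 \<in> disk"
  using radius by (simp add: disk_iff)

lemma disk_weakly_compact:
  fixes x :: "nat \<Rightarrow> 'a"
  assumes "\<And>n. x n \<in> disk"
  obtains l s where "strict_mono s" "weakly_converges (\<lambda>n. x (s n)) l" "l \<in> disk"
proof -
  have bdd: "norm (x n) \<le> \<rho>" for n using assms by (simp add: disk_iff)
  obtain l s where s: "strict_mono s" "weakly_converges (\<lambda>n. x (s n)) l" "norm l \<le> \<rho>"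
    by (rule B.weakly_convergent_subsequence[of x \<rho>, OF bdd])
  have "l \<bullet> f j = 0" if "j > k" for j
  proof -
    have "x (s n) \<bullet> f j = 0" for n using assms[of "s n"] that by (simp add: disk_iff)
    then show ?thesis
      using LIMSEQ_unique[OF weakly_converges_inner[OF s(2), of "f j"]] by simp
  qed
  then show ?thesis using that s by (simp add: disk_iff)
qed

text \<open>Displacements of the disk. Oddness is required globally, so that finite-dimensional sections are odd
too. The second condition is compactness: weak convergence in the disk becomes norm convergence of
\<open>h\<close>. The values of \<open>\<phi>\<close> must not increase; vanishing on the boundary of the disk would be
useless here, since the boundary is weakly dense in the disk and \<open>h\<close> would be zero.\<close>

definition admissible :: "('a \<Rightarrow>\<^sub>C 'a) \<Rightarrow> bool" where
  "admissible h \<longleftrightarrow> (\<forall>u. h (- u) = - h u) \<and>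
     (\<forall>x l. (\<forall>n. x n \<in> disk) \<longrightarrow> l \<in> disk \<longrightarrow> weakly_converges x l \<longrightarrow> (\<lambda>n. h (x n)) \<longlonglongrightarrow> h l) \<and>
     (\<forall>u\<in>disk. \<phi> (u - h u) \<le> \<phi> u)"

lemma admissible_odd: "admissible h \<Longrightarrow> h (- u) = - h u"
  by (simp add: admissible_def)

lemma admissible_compact:
  "admissible h \<Longrightarrow> (\<And>n. x n \<in> disk) \<Longrightarrow> l \<in> disk \<Longrightarrow> weakly_converges x l \<Longrightarrow> (\<lambda>n. h (x n)) \<longlonglongrightarrow> h l"
  by (simp add: admissible_def)

lemma admissible_descends: "admissible h \<Longrightarrow> u \<in> disk \<Longrightarrow> \<phi> (u - h u) \<le> \<phi> u"
  by (simp add: admissible_def)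

lemma admissible_zero: "admissible 0"
  by (simp add: admissible_def zero_bcontfun.rep_eq)

lemma continuous_\<phi>: "x \<longlonglongrightarrow> l \<Longrightarrow> (\<lambda>n. \<phi> (x n)) \<longlonglongrightarrow> \<phi> l"
  using C1_continuous[OF C1]
  by (simp add: continuous_on_eq_continuous_at isCont_tendsto_compose)

lemma bcontfun_tendsto_apply:
  fixes h :: "nat \<Rightarrow> 'a \<Rightarrow>\<^sub>C 'a"
  assumes "h \<longlonglongrightarrow> g"
  shows "(\<lambda>n. h n u) \<longlonglongrightarrow> g u"
proof (rule metric_LIMSEQ_I)
  fix d :: real assume "0 < d"
  then obtain N where "\<And>n. n \<ge> N \<Longrightarrow> dist (h n) g < d" using metric_LIMSEQ_D[OF assms] by blast
  then have "dist (h n u) (g u) < d" if "n \<ge> N" for n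
    using dist_bounded[of "h n" u g] that by (meson le_less_trans)
  then show "\<exists>N. \<forall>n\<ge>N. dist (h n u) (g u) < d" by blast
qed

lemma complete_admissible: "complete {h. admissible h}"
  unfolding complete_eq_closed closed_sequential_limits
proof (intro allI impI)
  fix h :: "nat \<Rightarrow> 'a \<Rightarrow>\<^sub>C 'a" and g
  assume "(\<forall>n. h n \<in> {h. admissible h}) \<and> h \<longlonglongrightarrow> g"
  then have adm: "\<And>n. admissible (h n)" and lim: "h \<longlonglongrightarrow> g" by auto
  note pointwise = bcontfun_tendsto_apply[OF lim]
  have "g (- u) = - g u" for u
    using LIMSEQ_unique[OF pointwise[of "- u"]] tendsto_minus[OF pointwise[of u]]
    by (simp add: admissible_odd[OF adm])
  moreover have "(\<lambda>n. g (x n)) \<longlonglongrightarrow> g l"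
    if x: "\<forall>n. x n \<in> disk" "l \<in> disk" "weakly_converges x l" for x l
  proof (rule metric_LIMSEQ_I)
    fix d :: real assume d: "0 < d"
    then obtain m where m: "dist (h m) g < d / 3"
      using metric_LIMSEQ_D[OF lim, of "d / 3"] by auto
    have close: "dist (h m u) (g u) < d / 3" for u
      using dist_bounded[of "h m" u g] m by (rule le_less_trans)
    have "(\<lambda>n. h m (x n)) \<longlonglongrightarrow> h m l"
      using x by (intro admissible_compact[OF adm]) auto
    then obtain N where N: "\<And>n. n \<ge> N \<Longrightarrow> dist (h m (x n)) (h m l) < d / 3"
      using metric_LIMSEQ_D[of _ _ "d / 3"] d by (metis zero_less_divide_iff zero_less_numeral)
    have "dist (g (x n)) (g l) < d" if "n \<ge> N" for n
    proof -
      have "dist (g (x n)) (g l) \<le> dist (h m (x n)) (g (x n)) + dist (h m (x n)) (h m l) + dist (h m l) (g l)"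
        using dist_triangle[of "g (x n)" "g l" "h m (x n)"] dist_triangle[of "h m (x n)" "g l" "h m l"]
        by (simp add: dist_commute)
      then show ?thesis using close[of "x n"] close[of l] N[OF that] by linarith
    qed
    then show "\<exists>N. \<forall>n\<ge>N. dist (g (x n)) (g l) < d" by blast
  qed
  moreover have "\<phi> (u - g u) \<le> \<phi> u" if "u \<in> disk" for u
    by (rule LIMSEQ_le_const2[OF continuous_\<phi>[OF tendsto_diff[OF tendsto_const pointwise]]])
       (use that admissible_descends[OF adm] in blast)
  ultimately show "g \<in> {h. admissible h}" by (simp add: admissible_def)
qed

lemma deformed_weakly_converges:
  assumes h: "admissible h" and x: "\<And>n. x n \<in> disk" "l \<in> disk" "weakly_converges x l"
    and z: "z \<longlonglongrightarrow> 0"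
  shows "weakly_converges (\<lambda>n. x n - h (x n) + z n) (l - h l)"
proof -
  have "weakly_converges (\<lambda>n. x n - h (x n) + z n) (l - h l + 0)"
    by (intro weakly_converges_add weakly_converges_diff x(3) weakly_converges_if_tendsto z
        admissible_compact[OF h x])
  then show ?thesis by simp
qed

text \<open>The differences \<open>x n - l\<close> are \<open>\<tau>\<close>-null because they are bounded in \<open>Y\<^sub>k\<close>, and the displacements
converge in norm.\<close>

lemma deformed_upper_semicontinuous:
  assumes h: "admissible h" and x: "\<And>n. x n \<in> disk" "l \<in> disk" "weakly_converges x l"
    and \<eta>: "\<eta> > 0"
  shows "\<forall>\<^sub>F n in sequentially. \<phi> (x n - h (x n)) < \<phi> (l - h l) + \<eta>"
proof (rule tau_weak_upper_semicontinuity[OF C1 weak tau_bound _ _ \<eta>])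
  show "weakly_converges (\<lambda>n. x n - h (x n)) (l - h l)"
    using deformed_weakly_converges[OF h x tendsto_const] by simp
  have "(\<lambda>n. tau (x n - l)) \<longlonglongrightarrow> 0"
  proof (rule tau_tendsto_zero)
    show "weakly_converges (\<lambda>n. x n - l) 0"
      using weakly_converges_diff[OF x(3) weakly_converges_if_tendsto[OF tendsto_const[of l]]] by simp
    show "norm (x n - l) \<le> \<rho> + \<rho>" for n
      using norm_triangle_ineq4[of "x n" l] x(1)[of n] x(2) by (simp add: disk_iff)
    show "(x n - l) \<bullet> f j = 0" if "j > k" for n j
      using x(1)[of n] x(2) that by (simp add: disk_iff inner_diff_left)
  qed
  moreover have "(\<lambda>n. norm (h l - h (x n))) \<longlonglongrightarrow> 0"
    using tendsto_diff[OF tendsto_const[of "h l"] admissible_compact[OF h x]]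
    by (simp add: tendsto_norm_zero)
  ultimately have "(\<lambda>n. tau (x n - l) + norm (h l - h (x n))) \<longlonglongrightarrow> 0"
    by (rule tendsto_add_zero)
  moreover have "norm (tau (x n - h (x n) - (l - h l))) \<le> tau (x n - l) + norm (h l - h (x n))" for n
  proof -
    have eq: "x n - h (x n) - (l - h l) = (x n - l) + (h l - h (x n))" by simp
    have "tau (x n - h (x n) - (l - h l)) \<le> tau (x n - l) + tau (h l - h (x n))"
      unfolding eq by (rule tau_triangle)
    then show ?thesis
      unfolding real_norm_def abs_of_nonneg[OF tau_nonneg]
      using tau_le_norm[of "h l - h (x n)"] by linarith
  qed
  ultimately show "(\<lambda>n. tau (x n - h (x n) - (l - h l))) \<longlonglongrightarrow> 0"
    by (rule Lim_null_comparison[OF always_eventually[OF allI], rotated])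
qed

text \<open>The orthogonal projection of the gradient at \<open>u - h u\<close> to the first \<open>N\<close> basis vectors. Being
finite-dimensional, it is continuous from the weak to the norm topology.\<close>

definition gradient_part :: "('a \<Rightarrow>\<^sub>C 'a) \<Rightarrow> nat \<Rightarrow> 'a \<Rightarrow> 'a" where
  "gradient_part h N u = (\<Sum>i<N. dual_deriv \<phi> (u - h u) (basis i) *\<^sub>R basis i)"

lemma dual_deriv_minus: "dual_deriv \<phi> (- u) v = - dual_deriv \<phi> u v"
proof -
  have "((\<lambda>s. \<phi> (- u + s *\<^sub>R v)) has_real_derivative dual_deriv \<phi> (- u + 0 *\<^sub>R v) v) (at 0)"
    by (rule C1_ray_derivative[OF C1])
  moreover have "((\<lambda>s. \<phi> (u + s *\<^sub>R (- v))) has_real_derivative dual_deriv \<phi> (u + 0 *\<^sub>R (- v)) (- v)) (at 0)"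
    by (rule C1_ray_derivative[OF C1])
  moreover have "\<phi> (- u + s *\<^sub>R v) = \<phi> (u + s *\<^sub>R (- v))" for s
    using even[of "u + s *\<^sub>R (- v)"] by simp
  ultimately show ?thesis
    using DERIV_unique by (fastforce simp: blinfun.minus_right)
qed

lemma gradient_part_odd:
  assumes "admissible h"
  shows "gradient_part h N (- u) = - gradient_part h N u"
proof -
  have "- u - h (- u) = - (u - h u)" by (simp add: admissible_odd[OF assms])
  then show ?thesis
    by (simp only: gradient_part_def dual_deriv_minus scaleR_minus_left sum_negf)
qed

lemma continuous_gradient_part: "continuous_on UNIV (gradient_part h N)"
proof -
  have "continuous_on UNIV (\<lambda>u. dual_deriv \<phi> (u - h u))"
  proof (rule continuous_on_compose2[where f = "\<lambda>u. u - h u" and g = "dual_deriv \<phi>"])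
    show "continuous_on UNIV (dual_deriv \<phi>)" using C1 by (simp add: C1_functional_def)
    show "continuous_on UNIV (\<lambda>u. u - h u)"
      by (intro continuous_on_diff continuous_on_id continuous_on_apply_bcontfun)
  qed simp
  then show ?thesis
    unfolding gradient_part_def
    by (intro continuous_on_sum continuous_on_scaleR blinfun.continuous_on continuous_on_const)
qed

lemma weak_dual_deriv:
  "weakly_converges x l \<Longrightarrow> (\<lambda>n. dual_deriv \<phi> (x n) v) \<longlonglongrightarrow> dual_deriv \<phi> l v"
  using weak by (simp add: gradient_weakly_seq_continuous_def)

lemma gradient_part_tendsto:
  assumes "admissible h" "\<And>n. x n \<in> disk" "l \<in> disk" "weakly_converges x l"
  shows "(\<lambda>n. gradient_part h N (x n)) \<longlonglongrightarrow> gradient_part h N l"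
  unfolding gradient_part_def
  using deformed_weakly_converges[OF assms tendsto_const]
  by (intro tendsto_sum tendsto_scaleR tendsto_const weak_dual_deriv) simp

lemma norm_gradient_part_mono:
  assumes "M \<le> N" shows "norm (gradient_part h M u) \<le> norm (gradient_part h N u)"
proof (rule power2_le_imp_le)
  show "(norm (gradient_part h M u))\<^sup>2 \<le> (norm (gradient_part h N u))\<^sup>2"
    using assms by (simp add: gradient_part_def B.norm_combination sum_mono2)
qed simp

text \<open>One truncation works for all points of the deformed disk at level at least \<open>c\<close>. These points form a
weakly closed set by semicontinuity; at a weak limit of counterexamples all projections of the gradient have norm
at most \<open>\<epsilon> / 2\<close>, hence so has the gradient.\<close>

lemma gradient_part_large:
  assumes h: "admissible h" and eps: "\<epsilon> > 0"
    and large: "\<And>u. u \<in> disk \<Longrightarrow> c \<le> \<phi> (u - h u) \<Longrightarrow> \<epsilon> \<le> norm (dual_deriv \<phi> (u - h u))"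
  obtains N where "\<And>u. u \<in> disk \<Longrightarrow> c \<le> \<phi> (u - h u) \<Longrightarrow> \<epsilon> / 2 < norm (gradient_part h N u)"
proof (rule ccontr)
  assume "\<not> thesis"
  then have "\<forall>N. \<exists>u. u \<in> disk \<and> c \<le> \<phi> (u - h u) \<and> norm (gradient_part h N u) \<le> \<epsilon> / 2"
    using that by (meson not_less)
  then obtain u where u: "\<And>N. u N \<in> disk" "\<And>N. c \<le> \<phi> (u N - h (u N))"
    "\<And>N. norm (gradient_part h N (u N)) \<le> \<epsilon> / 2"
    by metis
  obtain s l where s: "strict_mono s" "weakly_converges (\<lambda>n. u (s n)) l" "l \<in> disk"
    using disk_weakly_compact[of u] u(1) by blast
  have "c \<le> \<phi> (l - h l)"
  proof (rule field_le_epsilon)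
    fix \<eta> :: real assume "\<eta> > 0"
    from deformed_upper_semicontinuous[OF h u(1) s(3,2) this]
    obtain n where "\<phi> (u (s n) - h (u (s n))) < \<phi> (l - h l) + \<eta>"
      using eventually_happens' sequentially_bot by blast
    then show "c \<le> \<phi> (l - h l) + \<eta>" using u(2)[of "s n"] by linarith
  qed
  then have "\<epsilon> \<le> norm (dual_deriv \<phi> (l - h l))" using large s(3) by blast
  moreover have "norm (gradient_part h M l) \<le> \<epsilon> / 2" for M
  proof (rule LIMSEQ_le_const2[OF tendsto_norm[OF gradient_part_tendsto[OF h u(1) s(3,2)]]])
    have "norm (gradient_part h M (u (s n))) \<le> \<epsilon> / 2" if "n \<ge> M" for n
      using norm_gradient_part_mono[of M "s n" h "u (s n)"] seq_suble[OF s(1), of n] that u(3)[of "s n"]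
      by linarith
    then show "\<exists>n0. \<forall>n\<ge>n0. norm (gradient_part h M (u (s n))) \<le> \<epsilon> / 2" by blast
  qed
  then have "norm (dual_deriv \<phi> (l - h l)) \<le> \<epsilon> / 2"
    unfolding gradient_part_def by (rule B.norm_functional_le)
  ultimately show False using eps by linarith
qed

text \<open>Moving against the truncated gradient decreases \<open>\<phi>\<close> on the whole disk for all small steps. The cutoff
vanishes where the projection is small, so at a point of failure the projection has norm at least \<open>q\<close>;
along a weakly convergent sequence of failures the derivative in its direction converges to its
squared norm, too large for a failure.\<close>

lemma uniform_descent:
  fixes h :: "'a \<Rightarrow>\<^sub>C 'a" and N :: nat
  assumes h: "admissible h" and q: "q > 0"
  defines "V \<equiv> \<lambda>u. cutoff q (gradient_part h N u)"
  shows "\<forall>\<^sub>F n in sequentially. \<forall>u\<in>disk.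
     \<phi> (u - h u - (1 / real (Suc n)) *\<^sub>R V u) \<le> \<phi> (u - h u) - (1 / real (Suc n)) * (q / 2 * norm (V u))"
proof (rule ccontr)
  let ?g = "gradient_part h N"
  assume "\<not> ?thesis"
  from not_eventually_sequentiallyD[OF this] obtain r :: "nat \<Rightarrow> nat" where r: "strict_mono r"
    and bad: "\<And>n. \<exists>u\<in>disk. \<not> \<phi> (u - h u - (1 / real (Suc (r n))) *\<^sub>R V u) \<le> \<phi> (u - h u) - (1 / real (Suc (r n))) * (q / 2 * norm (V u))"
    by blast
  \<comment> \<open>A failure at \<open>u\<close>, expressed by the mean value theorem through the derivative on the segment.\<close>
  define flat where "flat n u \<theta> \<longleftrightarrow> u \<in> disk \<and> 0 \<le> \<theta> \<and> \<theta> \<le> 1 \<and> q < norm (?g u) \<and>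
      dual_deriv \<phi> (u - h u + (- \<theta> / real (Suc (r n))) *\<^sub>R V u) (?g u) \<le> q / 2 * norm (?g u)" for n u \<theta>
  have "\<exists>u \<theta>. flat n u \<theta>" for n
  proof -
    define t where "t = 1 / real (Suc (r n))"
    have t: "t > 0" by (simp add: t_def)
    obtain u where u: "u \<in> disk" "\<not> \<phi> (u - h u - t *\<^sub>R V u) \<le> \<phi> (u - h u) - t * (q / 2 * norm (V u))"
      using bad[of n] unfolding t_def by blast
    obtain \<theta> where \<theta>: "0 < \<theta>" "\<theta> < 1" "\<phi> (u - h u + (- t) *\<^sub>R V u) - \<phi> (u - h u) =
        dual_deriv \<phi> (u - h u + \<theta> *\<^sub>R ((- t) *\<^sub>R V u)) ((- t) *\<^sub>R V u)"
      by (rule C1_mean_value[OF C1])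
    let ?D = "dual_deriv \<phi> (u - h u + \<theta> *\<^sub>R ((- t) *\<^sub>R V u))"
    have "t * ?D (V u) < t * (q / 2 * norm (V u))"
      using \<theta>(3) u(2) by (simp add: blinfun.scaleR_right blinfun.minus_right)
    then have D: "?D (V u) < q / 2 * norm (V u)" using t by simp
    then have "V u \<noteq> 0" by auto
    then have g: "q < norm (?g u)" using cutoff_eq_0[of "?g u" q] by (force simp: V_def)
    obtain a where a: "a > 0" "V u = a *\<^sub>R ?g u" using cutoff_positive_multiple[OF q g] by (metis V_def)
    have "a * ?D (?g u) < a * (q / 2 * norm (?g u))"
      using D a(1) unfolding a(2) by (simp add: blinfun.scaleR_right mult.left_commute)
    then have "?D (?g u) < q / 2 * norm (?g u)" using a(1) by simp
    moreover have "\<theta> *\<^sub>R ((- t) *\<^sub>R V u) = (- \<theta> / real (Suc (r n))) *\<^sub>R V u" by (simp add: t_def)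
    ultimately have "dual_deriv \<phi> (u - h u + (- \<theta> / real (Suc (r n))) *\<^sub>R V u) (?g u) < q / 2 * norm (?g u)"
      by (simp only:)
    then have "flat n u \<theta>" unfolding flat_def using u(1) \<theta>(1,2) g by (intro conjI less_imp_le)
    then show ?thesis by blast
  qed
  then obtain u \<theta> where "\<And>n. flat n (u n) (\<theta> n)" by metis
  then have u: "\<And>n. u n \<in> disk" and \<theta>: "\<And>n. 0 \<le> \<theta> n" "\<And>n. \<theta> n \<le> 1"
    and g: "\<And>n. q < norm (?g (u n))"
    and D: "\<And>n. dual_deriv \<phi> (u n - h (u n) + (- \<theta> n / real (Suc (r n))) *\<^sub>R V (u n)) (?g (u n)) \<le> q / 2 * norm (?g (u n))"
    unfolding flat_def by blast+
  obtain s l where s: "strict_mono s" "weakly_converges (\<lambda>n. u (s n)) l" "l \<in> disk"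
    using disk_weakly_compact[of u] u by blast
  have rs: "strict_mono (\<lambda>n. r (s n))" using strict_mono_o[OF r s(1)] by (simp add: o_def)
  have "(\<lambda>n. (- \<theta> (s n) / real (Suc (r (s n)))) *\<^sub>R V (u (s n))) \<longlonglongrightarrow> 0"
  proof (rule Lim_null_comparison[OF always_eventually[OF allI]])
    show "norm ((- \<theta> (s n) / real (Suc (r (s n)))) *\<^sub>R V (u (s n))) \<le> 1 / real (Suc (r (s n)))" for n
    proof -
      have "\<theta> (s n) * norm (V (u (s n))) \<le> 1 * 1"
        using \<theta> norm_cutoff_le[OF q] by (intro mult_mono) (auto simp: V_def)
      then show ?thesis using \<theta>(1)[of "s n"] by (simp add: divide_right_mono)
    qed
    show "(\<lambda>n. 1 / real (Suc (r (s n)))) \<longlonglongrightarrow> 0"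
      using LIMSEQ_subseq_LIMSEQ[OF LIMSEQ_Suc[OF lim_const_over_n[of 1]] rs] by (simp add: o_def)
  qed
  then have xi: "weakly_converges (\<lambda>n. u (s n) - h (u (s n)) + (- \<theta> (s n) / real (Suc (r (s n)))) *\<^sub>R V (u (s n))) (l - h l)"
    by (rule deformed_weakly_converges[OF h u s(3,2)])
  have g_lim: "(\<lambda>n. ?g (u (s n))) \<longlonglongrightarrow> ?g l" by (rule gradient_part_tendsto[OF h u s(3,2)])
  let ?c = "\<lambda>u i. dual_deriv \<phi> (u - h u) (basis i)"
  have "(\<lambda>n. dual_deriv \<phi> (u (s n) - h (u (s n)) + (- \<theta> (s n) / real (Suc (r (s n)))) *\<^sub>R V (u (s n))) (?g (u (s n))))
     \<longlonglongrightarrow> (\<Sum>i<N. ?c l i * ?c l i)"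
    unfolding gradient_part_def blinfun.sum_right blinfun.scaleR_right real_scaleR_def
    using deformed_weakly_converges[OF h u s(3,2) tendsto_const]
    by (intro tendsto_sum tendsto_mult weak_dual_deriv xi[unfolded gradient_part_def]) simp_all
  also have "(\<Sum>i<N. ?c l i * ?c l i) = (norm (?g l))\<^sup>2"
    unfolding gradient_part_def B.norm_combination[OF finite_lessThan] by (simp add: power2_eq_square)
  finally have "(norm (?g l))\<^sup>2 \<le> q / 2 * norm (?g l)"
    by (rule LIMSEQ_le[OF _ tendsto_mult[OF tendsto_const tendsto_norm[OF g_lim]]]) (use D in blast)
  then have "norm (?g l) \<le> q / 2" by (rule le_if_power2_le_mult) (use q in simp)
  moreover have "q \<le> norm (?g l)"
    by (rule LIMSEQ_le_const[OF tendsto_norm[OF g_lim]]) (use g in \<open>blast intro: less_imp_le\<close>)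
  ultimately show False using q by simp
qed

end

section \<open>Lowering the maximal level\<close>

context fountain_level
begin

definition level :: "('a \<Rightarrow>\<^sub>C 'a) \<Rightarrow> real" where
  "level h = (SUP u\<in>disk. \<phi> (u - h u))"

context
  fixes D :: real
  assumes D: "\<And>u. u \<in> disk \<Longrightarrow> \<phi> u \<le> D"
begin

lemma level_upper:
  fixes h :: "'a \<Rightarrow>\<^sub>C 'a"
  assumes "admissible h" "u \<in> disk"
  shows "\<phi> (u - h u) \<le> level h"
  unfolding level_def
proof (rule cSUP_upper[OF assms(2)])
  show "bdd_above ((\<lambda>u. \<phi> (u - h u)) ` disk)"
    by (rule bdd_aboveI2[of _ _ D]) (use admissible_descends[OF assms(1)] D order_trans in blast)
qed

lemma level_least:
  fixes h :: "'a \<Rightarrow>\<^sub>C 'a"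
  assumes "\<And>u. u \<in> disk \<Longrightarrow> \<phi> (u - h u) \<le> a"
  shows "level h \<le> a"
  unfolding level_def by (rule cSUP_least) (use zero_in_disk assms in auto)

lemma level_lower_semicontinuous:
  fixes h :: "nat \<Rightarrow> 'a \<Rightarrow>\<^sub>C 'a"
  assumes h: "\<And>n. admissible (h n)" "h \<longlonglongrightarrow> g" and a: "\<And>n. level (h n) \<le> a"
  shows "level g \<le> a"
proof (rule level_least)
  fix u assume u: "u \<in> disk"
  show "\<phi> (u - g u) \<le> a"
  proof (rule LIMSEQ_le_const2[OF continuous_\<phi>[OF tendsto_diff[OF tendsto_const bcontfun_tendsto_apply[OF h(2)]]]])
    have "\<phi> (u - h n u) \<le> a" for n using level_upper[OF h(1) u] a order_trans by blast
    then show "\<exists>N. \<forall>n\<ge>N. \<phi> (u - h n u) \<le> a" by blast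
  qed
qed

text \<open>Take a short step against the truncated gradient. If the level did not drop by the claimed
amount for any small step, then there would be points of almost maximal value whose cutoff gradient
is shorter than \<open>1 / 2\<close>, while a weak limit of them is a maximum point for \<open>h\<close>, and there the cutoff
gradient has norm 1.\<close>

lemma level_improvable:
  fixes h :: "'a \<Rightarrow>\<^sub>C 'a"
  assumes h: "admissible h" and eps: "\<epsilon> > 0"
    and large: "\<And>u. u \<in> disk \<Longrightarrow> level h \<le> \<phi> (u - h u) \<Longrightarrow> \<epsilon> \<le> norm (dual_deriv \<phi> (u - h u))"
  obtains g where "admissible g" "level g + \<epsilon> / 16 * dist g h \<le> level h" "g \<noteq> h"
proof -
  \<comment> \<open>Then \<open>2 * q = \<epsilon> / 2\<close> is the bound for the truncated gradient, and the descent rate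
    \<open>q / 2 * norm (V u)\<close> is at least \<open>\<epsilon> / 16\<close> wherever \<open>norm (V u) \<ge> 1 / 2\<close>.\<close>
  define q where "q = \<epsilon> / 4"
  have q: "q > 0" using eps by (simp add: q_def)
  obtain N where N: "\<And>u. u \<in> disk \<Longrightarrow> level h \<le> \<phi> (u - h u) \<Longrightarrow> 2 * q < norm (gradient_part h N u)"
    using gradient_part_large[OF h eps large] unfolding q_def by auto
  define V where "V u = cutoff q (gradient_part h N u)" for u
  have contV: "continuous_on UNIV V"
    unfolding V_def
    by (rule continuous_on_compose2[OF continuous_cutoff[OF q] continuous_gradient_part]) simp
  have normV: "norm (V u) \<le> 1" for u unfolding V_def by (rule norm_cutoff_le[OF q])
  have "V \<in> bcontfun"
    by (rule bcontfun_normI[OF contV normV])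
  then have V_apply: "apply_bcontfun (Bcontfun V) = V" by (rule Bcontfun_inverse)
  define H where "H n = h + (1 / real (Suc n)) *\<^sub>R Bcontfun V" for n :: nat
  have H_apply: "H n u = h u + (1 / real (Suc n)) *\<^sub>R V u" for n u
    by (simp add: H_def V_apply plus_bcontfun.rep_eq scaleR_bcontfun.rep_eq)
  have cont_cutoff: "continuous_on UNIV (cutoff q :: 'a \<Rightarrow> 'a)" by (rule continuous_cutoff[OF q])
  have V_weak: "(\<lambda>n. V (x n)) \<longlonglongrightarrow> V l" if "\<And>n. x n \<in> disk" "l \<in> disk" "weakly_converges x l" for x l
    unfolding V_def
    by (rule isCont_tendsto_compose[OF _ gradient_part_tendsto[OF h that]])
       (use cont_cutoff in \<open>simp add: continuous_on_eq_continuous_at\<close>)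
  define descends where "descends n \<longleftrightarrow> (\<forall>u\<in>disk.
     \<phi> (u - H n u) \<le> \<phi> (u - h u) - (1 / real (Suc n)) * (q / 2 * norm (V u)))" for n
  have ev: "\<forall>\<^sub>F n in sequentially. descends n"
    using uniform_descent[OF h q, of N] by (simp add: descends_def H_apply V_def diff_diff_eq)
  have adm: "admissible (H n)" if "descends n" for n
    unfolding admissible_def
  proof (intro conjI allI impI ballI)
    show "H n (- u) = - H n u" for u
      by (simp add: H_apply V_def gradient_part_odd[OF h] cutoff_minus admissible_odd[OF h])
    show "(\<lambda>m. H n (x m)) \<longlonglongrightarrow> H n l" if "\<forall>n. x n \<in> disk" "l \<in> disk" "weakly_converges x l" for x l
      unfolding H_apply
      by (intro tendsto_add tendsto_scaleR tendsto_const admissible_compact[OF h] V_weak) (use that in auto)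
    show "\<phi> (u - H n u) \<le> \<phi> u" if u: "u \<in> disk" for u
    proof -
      have "0 \<le> (1 / real (Suc n)) * (q / 2 * norm (V u))" using q by simp
      then show ?thesis
        using \<open>descends n\<close> u admissible_descends[OF h u] unfolding descends_def by fastforce
    qed
  qed
  have "\<exists>n. descends n \<and> level (H n) \<le> level h - \<epsilon> / 16 * (1 / real (Suc n))"
  proof (rule ccontr)
    assume none: "\<not> ?thesis"
    obtain n0 where n0: "\<And>n. n \<ge> n0 \<Longrightarrow> descends n" using ev unfolding eventually_sequentially by blast
    have "\<exists>u. u \<in> disk \<and> level h - \<epsilon> / 16 * (1 / real (Suc (n0 + n))) < \<phi> (u - h u) \<and> norm (V u) < 1 / 2" for n
    proof -
      define t where "t = 1 / real (Suc (n0 + n))"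
      have t: "t > 0" by (simp add: t_def)
      have desc: "descends (n0 + n)" by (rule n0) simp
      then have "\<not> level (H (n0 + n)) \<le> level h - \<epsilon> / 16 * t" using none unfolding t_def by blast
      then obtain u where u: "u \<in> disk" "level h - \<epsilon> / 16 * t < \<phi> (u - H (n0 + n) u)"
        using level_least by (meson not_less)
      have "\<phi> (u - H (n0 + n) u) \<le> \<phi> (u - h u) - t * (q / 2 * norm (V u))"
        using desc u(1) by (simp add: descends_def t_def)
      moreover have "0 \<le> t * (q / 2 * norm (V u))" using t q by simp
      moreover have "\<phi> (u - h u) \<le> level h" by (rule level_upper[OF h u(1)])
      ultimately have *: "t * (q / 2 * norm (V u)) < t * (\<epsilon> / 16)" "level h - \<epsilon> / 16 * t < \<phi> (u - h u)"
        using u(2) mult.commute[of "\<epsilon> / 16" t] by linarith+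
      then have "q / 2 * norm (V u) < \<epsilon> / 16" using t by simp
      then have "\<epsilon> * (2 * norm (V u)) < \<epsilon> * 1" by (simp add: q_def)
      then have "norm (V u) < 1 / 2" using eps by simp
      then show ?thesis using u(1) *(2) unfolding t_def by blast
    qed
    then obtain u where u: "\<And>n. u n \<in> disk" "\<And>n. level h - \<epsilon> / 16 * (1 / real (Suc (n0 + n))) < \<phi> (u n - h (u n))"
      "\<And>n. norm (V (u n)) < 1 / 2" by metis
    obtain s l where s: "strict_mono s" "weakly_converges (\<lambda>n. u (s n)) l" "l \<in> disk"
      using disk_weakly_compact[of u] u(1) by blast
    have "(\<lambda>n. 1 / real (Suc (n0 + n))) \<longlonglongrightarrow> 0"
      using LIMSEQ_ignore_initial_segment[OF LIMSEQ_Suc[OF lim_const_over_n[of 1]], of n0]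
      by (simp add: add.commute)
    then have "(\<lambda>n. 1 / real (Suc (n0 + s n))) \<longlonglongrightarrow> 0"
      using LIMSEQ_subseq_LIMSEQ[OF _ s(1)] by (fastforce simp: o_def)
    then have lim: "(\<lambda>n. level h - \<epsilon> / 16 * (1 / real (Suc (n0 + s n)))) \<longlonglongrightarrow> level h - \<epsilon> / 16 * 0"
      by (intro tendsto_diff tendsto_mult tendsto_const)
    have "level h \<le> \<phi> (l - h l)"
    proof (rule field_le_epsilon)
      fix \<eta> :: real assume \<eta>: "\<eta> > 0"
      have "\<forall>\<^sub>F n in sequentially. level h - \<epsilon> / 16 * (1 / real (Suc (n0 + s n))) \<le> \<phi> (l - h l) + \<eta>"
        using deformed_upper_semicontinuous[OF h u(1) s(3,2) \<eta>]
      proof eventually_elim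
        case (elim n)
        then show ?case using u(2)[of "s n"] by linarith
      qed
      then have "level h - \<epsilon> / 16 * 0 \<le> \<phi> (l - h l) + \<eta>"
        using tendsto_upperbound[OF lim] by simp
      then show "level h \<le> \<phi> (l - h l) + \<eta>" by simp
    qed
    then have "2 * q < norm (gradient_part h N l)" using N s(3) by blast
    then have "\<forall>\<^sub>F n in sequentially. 2 * q < norm (gradient_part h N (u (s n)))"
      by (rule order_tendstoD(1)[OF tendsto_norm[OF gradient_part_tendsto[OF h u(1) s(3,2)]]])
    then obtain n where "2 * q < norm (gradient_part h N (u (s n)))"
      using eventually_happens' sequentially_bot by blast
    then have "norm (V (u (s n))) = 1" unfolding V_def by (intro norm_cutoff_eq_1 q) simp
    then show False using u(3)[of "s n"] by simp
  qed
  then obtain n where n: "descends n" "level (H n) \<le> level h - \<epsilon> / 16 * (1 / real (Suc n))" by blast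
  have "dist (H n) h \<le> 1 / real (Suc n)"
  proof (rule dist_bound)
    fix u show "dist (H n u) (h u) \<le> 1 / real (Suc n)"
      using normV[of u] by (simp add: H_apply dist_norm divide_right_mono)
  qed
  then have "\<epsilon> / 16 * dist (H n) h \<le> \<epsilon> / 16 * (1 / real (Suc n))" using eps by (intro mult_left_mono) auto
  moreover have "0 < \<epsilon> / 16 * (1 / real (Suc n))" using eps by simp
  ultimately show ?thesis using that[OF adm[OF n(1)]] n(2) by fastforce
qed

lemma almost_critical_value:
  assumes linked: "\<And>h :: 'a \<Rightarrow>\<^sub>C 'a. admissible h \<Longrightarrow> \<exists>u\<in>disk. c \<le> \<phi> (u - h u)" and eps: "\<epsilon> > 0"
  shows "\<exists>x. c \<le> \<phi> x \<and> \<phi> x \<le> D \<and> norm (dual_deriv \<phi> x) < \<epsilon>"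
proof (rule ccontr)
  assume none: "\<not> ?thesis"
  have below: "c \<le> level h" if "h \<in> {h. admissible h}" for h
    using linked[of h] level_upper[of h] that by fastforce
  have "\<exists>h\<in>{h. admissible h}. \<forall>g\<in>{h. admissible h}. level g + \<epsilon> / 16 * dist g h \<le> level h \<longrightarrow> g = h"
  proof (rule ekeland[OF complete_admissible _ below])
    show "0 \<in> {h. admissible h}" using admissible_zero by simp
    show "0 < \<epsilon> / 16" using eps by simp
    fix x :: "nat \<Rightarrow> 'a \<Rightarrow>\<^sub>C 'a" and l a
    assume "\<And>n. x n \<in> {h. admissible h}" "x \<longlonglongrightarrow> l" "\<And>n. level (x n) \<le> a"
    then show "level l \<le> a" by (intro level_lower_semicontinuous[of x l a]) simp_all
  qed
  then obtain h where h: "h \<in> {h. admissible h}"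
    "\<And>g. g \<in> {h. admissible h} \<Longrightarrow> level g + \<epsilon> / 16 * dist g h \<le> level h \<Longrightarrow> g = h"
    by blast
  have adm: "admissible h" using h(1) by simp
  obtain g where "admissible g" "level g + \<epsilon> / 16 * dist g h \<le> level h" "g \<noteq> h"
  proof (rule level_improvable[OF adm eps])
    fix u assume u: "u \<in> disk" "level h \<le> \<phi> (u - h u)"
    have "c \<le> \<phi> (u - h u)" using below[OF h(1)] u(2) by linarith
    moreover have "\<phi> (u - h u) \<le> D" using admissible_descends[OF adm u(1)] D[OF u(1)] by linarith
    ultimately show "\<epsilon> \<le> norm (dual_deriv \<phi> (u - h u))" using none by (meson not_less)
  qed
  then show False using h(2)[of g] by simp
qed

end
end

section \<open>The fountain theorem\<close>

text \<open>The Palais-Smale condition bounds \<open>\<phi>\<close> only from above; the lower bound \<open>c\<close> passes to the limit by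
continuity.\<close>

lemma critical_value_above:
  fixes \<phi> :: "'a::real_normed_vector \<Rightarrow> real"
  assumes C1: "C1_functional \<phi>" and PS: "PS_condition \<phi> D"
    and almost: "\<And>\<epsilon>. \<epsilon> > 0 \<Longrightarrow> \<exists>x. c \<le> \<phi> x \<and> \<phi> x \<le> D \<and> norm (dual_deriv \<phi> x) < \<epsilon>"
  obtains u where "critical_point \<phi> u" "c \<le> \<phi> u"
proof -
  have "\<forall>n. \<exists>x. c \<le> \<phi> x \<and> \<phi> x \<le> D \<and> norm (dual_deriv \<phi> x) < 1 / real (Suc n)"
    using almost by simp
  then obtain x where x: "\<And>n. c \<le> \<phi> (x n)" "\<And>n. \<phi> (x n) \<le> D"
    "\<And>n. norm (dual_deriv \<phi> (x n)) < 1 / real (Suc n)" by metis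
  have null: "(\<lambda>n. dual_deriv \<phi> (x n)) \<longlonglongrightarrow> 0"
    by (rule Lim_null_comparison[OF always_eventually LIMSEQ_Suc[OF lim_const_over_n[of 1]]])
       (use x(3) in \<open>auto intro: less_imp_le\<close>)
  moreover have "(SUP n. ereal (\<phi> (x n))) \<le> ereal D" using x(2) by (intro SUP_least) simp
  ultimately obtain s where s: "strict_mono s" "convergent (x \<circ> s)"
    using PS unfolding PS_condition_def by blast
  then obtain l where l: "(\<lambda>n. x (s n)) \<longlonglongrightarrow> l" by (auto simp: convergent_def o_def)
  have "dual_deriv \<phi> l = 0"
    using LIMSEQ_unique[OF C1_continuous_deriv[OF C1 l]] LIMSEQ_subseq_LIMSEQ[OF null s(1)]
    by (simp add: o_def)
  moreover have "(\<lambda>n. \<phi> (x (s n))) \<longlonglongrightarrow> \<phi> l"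
    by (rule isCont_tendsto_compose[OF _ l])
       (use C1_continuous[OF C1] in \<open>simp add: continuous_on_eq_continuous_at\<close>)
  then have "c \<le> \<phi> l" by (rule LIMSEQ_le_const) (use x(1) in blast)
  ultimately show ?thesis using that by (simp add: critical_point_def)
qed

theorem theorem1p2:
  fixes Y :: "'a::{real_inner, complete_space} set"
    and e f :: "nat \<Rightarrow> 'a"
    and \<phi> :: "'a \<Rightarrow> real"
    and \<rho> r :: "nat \<Rightarrow> real"
  assumes separable: "separable_space (euclidean :: 'a topology)"
    and Y: "subspace Y" "closed Y"
    and e: "orthonormal_basis_of Y e"
    and f: "orthonormal_basis_of (orthogonal_comp Y) f"
    and C1: "C1_functional \<phi>"
    and even: "\<And>u. \<phi> (- u) = \<phi> u"
    and weak: "gradient_weakly_seq_continuous \<phi>"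
    and PS: "\<And>c. PS_condition \<phi> c"
    and radii: "\<And>k. 0 < r k \<and> r k < \<rho> k"
    and A1: "\<And>k. (SUP u\<in>{u \<in> Yk Y f k. norm u \<le> \<rho> k}. ereal (\<phi> u)) < \<infinity>"
    and A2': "\<And>k. (SUP u\<in>{u \<in> Yk Y f k. norm u = \<rho> k}. ereal (\<phi> u))
                 < (INF u\<in>{u \<in> Zk f k. norm u \<le> r k}. ereal (\<phi> u))"
    and A3: "(\<lambda>k. INF u\<in>{u \<in> Zk f k. norm u = r k}. ereal (\<phi> u)) \<longlonglongrightarrow> \<infinity>"
    and A4: "\<And>\<delta>. \<delta> > 0 \<Longrightarrow>
               \<exists>C. (SUP u\<in>{u. tau_norm Y e u < \<delta>}. ereal (\<phi> u)) \<le> ereal C"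
  shows "\<exists>u :: nat \<Rightarrow> 'a. (\<forall>m. critical_point \<phi> (u m)) \<and>
           filterlim (\<lambda>m. norm (u m)) at_top sequentially"
proof -
  interpret S: splitting Y e f using Y(1) e f by unfold_locales
  have tau_bound: "\<exists>C. \<forall>u. tau_norm Y e u < \<delta> \<longrightarrow> \<phi> u \<le> C" if \<delta>: "\<delta> > 0" for \<delta>
  proof -
    obtain C where "(SUP u\<in>{u. tau_norm Y e u < \<delta>}. ereal (\<phi> u)) \<le> ereal C" using A4[OF \<delta>] by blast
    then have "\<forall>u\<in>{u. tau_norm Y e u < \<delta>}. ereal (\<phi> u) \<le> ereal C" unfolding SUP_le_iff .
    then show ?thesis by auto
  qed
  have "\<exists>u. critical_point \<phi> u \<and> real m \<le> norm u" for m
  proof -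
    obtain C where C: "\<And>u. tau_norm Y e u < real (Suc m) \<Longrightarrow> \<phi> u \<le> C"
      using tau_bound[of "real (Suc m)"] by auto
    have "\<forall>\<^sub>F k in sequentially. ereal (C + 1) < (INF u\<in>{u \<in> Zk f k. norm u = r k}. ereal (\<phi> u))"
      by (rule order_tendstoD(1)[OF A3]) simp
    then obtain k where k: "ereal (C + 1) < (INF u\<in>{u \<in> Zk f k. norm u = r k}. ereal (\<phi> u))"
      using eventually_happens' sequentially_bot by blast
    have \<rho>_pos: "0 < \<rho> k" using radii[of k] by simp
    interpret fountain_level Y e f \<phi> k "\<rho> k"
      by unfold_locales (fact C1, fact even, fact weak, fact tau_bound, fact \<rho>_pos)
    obtain n :: nat where n: "(SUP u\<in>disk. ereal (\<phi> u)) < ereal (real n)"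
      using less_PInf_Ex_of_nat[THEN iffD1, OF less_imp_neq[OF A1[of k]]]
      unfolding disk_def[symmetric] by blast
    have D: "\<phi> u \<le> real n" if "u \<in> disk" for u
    proof -
      have "ereal (\<phi> u) < ereal (real n)" using SUP_upper[OF that] n by (rule le_less_trans)
      then show ?thesis by simp
    qed
    have linked: "\<exists>u\<in>disk. C + 1 \<le> \<phi> (u - h u)" if h: "admissible h" for h :: "'a \<Rightarrow>\<^sub>C 'a"
    proof -
      have "\<exists>u\<in>Yk Y f k. norm u \<le> \<rho> k \<and> u - h u \<in> Zk f k \<and> norm (u - h u) = r k"
      proof (rule S.odd_compact_displacement_linking)
        show "continuous_on UNIV (apply_bcontfun h)" by simp
        show "h (- u) = - h u" for u by (rule admissible_odd[OF h])
        show "0 < r k" "0 < \<rho> k" using radii[of k] by auto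
      next
        fix x :: "nat \<Rightarrow> 'a" and l
        assume x: "\<And>n. x n \<in> Yk Y f k \<and> norm (x n) \<le> \<rho> k" "l \<in> Yk Y f k" "norm l \<le> \<rho> k"
          and "weakly_converges x l"
        then show "(\<lambda>n. h (x n)) \<longlonglongrightarrow> h l"
          by (intro admissible_compact[OF h]) (simp_all add: disk_def)
      next
        fix u assume u: "u \<in> Yk Y f k" "norm u = \<rho> k" "u - h u \<in> Zk f k"
        show "r k < norm (u - h u)"
        proof (rule ccontr)
          assume "\<not> r k < norm (u - h u)"
          then have "(INF u\<in>{u \<in> Zk f k. norm u \<le> r k}. ereal (\<phi> u)) \<le> ereal (\<phi> (u - h u))"
            using u(3) by (intro INF_lower) simp
          also have "\<dots> \<le> ereal (\<phi> u)"
            using admissible_descends[OF h, of u] u by (simp add: disk_def)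
          also have "\<dots> \<le> (SUP u\<in>{u \<in> Yk Y f k. norm u = \<rho> k}. ereal (\<phi> u))"
            using u by (intro SUP_upper) simp
          finally show False using A2'[of k] by simp
        qed
      qed
      then obtain u where u: "u \<in> Yk Y f k" "norm u \<le> \<rho> k" "u - h u \<in> Zk f k" "norm (u - h u) = r k"
        by blast
      have "(INF u\<in>{u \<in> Zk f k. norm u = r k}. ereal (\<phi> u)) \<le> ereal (\<phi> (u - h u))"
        using u by (intro INF_lower) simp
      with k have "ereal (C + 1) < ereal (\<phi> (u - h u))" by (rule less_le_trans)
      then show ?thesis using u(1,2) by (intro bexI[of _ u]) (auto simp: disk_def)
    qed
    obtain u where u: "critical_point \<phi> u" "C + 1 \<le> \<phi> u"
      by (rule critical_value_above[OF C1 PS almost_critical_value[OF D linked]])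
    have "real m \<le> norm u"
    proof (rule ccontr)
      assume "\<not> real m \<le> norm u"
      then have "tau_norm Y e u < real (Suc m)" using S.tau_le_norm[of u] by simp
      then show False using C[of u] u(2) by simp
    qed
    then show ?thesis using u(1) by blast
  qed
  then obtain u where u: "\<And>m. critical_point \<phi> (u m)" "\<And>m. real m \<le> norm (u m)" by metis
  have "filterlim (\<lambda>m. norm (u m)) at_top sequentially"
    by (rule filterlim_at_top_mono[OF filterlim_real_sequentially]) (simp add: u(2))
  then show ?thesis using u(1) by blast
qed

end
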